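(* Let $(\mathbb{E},\mathcal{E})$ be a measurable space, $\Phi:\mathbb{R}^d\times\mathbb{E}\to\mathbb{R}^d$ measurable, $\varepsilon_1,\varepsilon_2,\dots$ i.i.d. random elements of $\mathbb{E}$ independent of the $\mathbb{R}^d$-valued random vector $X_0$, and define $X_t=\Phi(X_{t-1},\varepsilon_t)$ for $t=1,2,\dots$. Assume: (RV) there exist $\alpha>0$ and a non-degenerate probability measure $\Upsilon$ on $\mathbb{S}^{d-1}$ such that $\lim_{x\to\infty}\Pr(\|X_0\|>ux,\ X_0/\|X_0\|\in S\mid \|X_0\|>x)=u^{-\alpha}\Upsilon(S)$ for all $u\ge 1$ and all Borel $S\subset\mathbb{S}^{d-1}$ with $\Upsilon(\partial S)=0$; (Phi) there exists a measurable $\phi:\mathbb{S}^{d-1}\times\mathbb{E}\to\mathbb{R}^d$ such that for all $e\in\mathbb{E}$, $\lim_{x\to\infty}x^{-1}\Phi(xs(x),e)=\phi(s,e)$ whenever $s(x)\to s$ in $\mathbb{S}^{d-1}$; and if $\Pr(\phi(s,\varepsilon_1)=0)>0$ for some $s\in\mathbb{S}^{d-1}$, then $\Pr(\varepsilon_1\in\mathbb{W})=1$ for a measurable $\mathbb{W}\subset\mathbb{E}$ such that $\sup_{\|y\|\le x}\|\Phi(y,e)\|=O(x)$ as $x\to\infty$ for every $e\in\mathbb{W}$. Extend $\phi$ to $\mathbb{R}^d\times\mathbb{E}$ by $\phi(v,e)=\|v\|\phi(v/\|v\|,e)$ for $v\ne0$ and $\phi(0,e)=0$. Then for every integer $t\ge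 0$, as $x\to\infty$, $$\mathcal{L}\Big(\tfrac{\|X_0\|}{x},\tfrac{X_0}{\|X_0\|},\tfrac{X_1}{\|X_0\|},\dots,\tfrac{X_t}{\|X_0\|}\ \Big|\ \|X_0\|>x\Big)\Rightarrow \mathcal{L}(Y,M_0,M_1,\dots,M_t),$$ where $M_j=\phi(M_{j-1},\varepsilon_j)$ for $j\ge1$, and $Y,M_0,\varepsilon_1,\varepsilon_2,\dots$ are independent with $\Pr(Y>y)=y^{-\alpha}$ for $y\ge1$ and $\mathcal{L}(M_0)=\Upsilon$.
   Context: $\|\cdot\|$ is the Euclidean norm, $\mathbb{S}^{d-1}$ the unit sphere in $\mathbb{R}^d$, $\mathcal{L}(\cdot)$ denotes law and $\Rightarrow$ weak convergence. The process $\{M_t\}$ is called the forward tail chain. *)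

theory Defs
  imports "HOL-Probability.Probability"
begin

primrec Xseq :: "('a \<Rightarrow> 'e \<Rightarrow> 'a) \<Rightarrow> ('w \<Rightarrow> 'a) \<Rightarrow> (nat \<Rightarrow> 'w \<Rightarrow> 'e) \<Rightarrow> nat \<Rightarrow> 'w \<Rightarrow> 'a" where
  "Xseq Phi X0 eps 0 \<omega> = X0 \<omega>"
| "Xseq Phi X0 eps (Suc t) \<omega> = Phi (Xseq Phi X0 eps t \<omega>) (eps (Suc t) \<omega>)"

definition phi_ext :: "('a::real_normed_vector \<Rightarrow> 'e \<Rightarrow> 'a) \<Rightarrow> 'a \<Rightarrow> 'e \<Rightarrow> 'a" where
  "phi_ext phi v e = (if v = 0 then 0 else norm v *\<^sub>R phi (v /\<^sub>R norm v) e)"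

text \<open>Embedding of a finite tuple (v_0,...,v_t) as a sequence that is zero after index t.\<close>
definition trunc_seq :: "nat \<Rightarrow> (nat \<Rightarrow> 'a::zero) \<Rightarrow> nat \<Rightarrow> 'a" where
  "trunc_seq t v j = (if j \<le> t then v j else 0)"

text \<open>Independence of two random elements with possibly different value types
  (the library's indep_var requires equal types; this is its characterisation indep_var_eq).\<close>
definition indep_var_het :: "'w measure \<Rightarrow> 'a measure \<Rightarrow> ('w \<Rightarrow> 'a) \<Rightarrow> 'b measure \<Rightarrow> ('w \<Rightarrow> 'b) \<Rightarrow> bool" where
  "indep_var_het M Ma X Mb Y \<longleftrightarrow>
     X \<in> M \<rightarrow>\<^sub>M Ma \<and> Y \<in> M \<rightarrow>\<^sub>M Mb \<and>
     prob_space.indep_set M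
       (sigma_sets (space M) {X -` A \<inter> space M | A. A \<in> sets Ma})
       (sigma_sets (space M) {Y -` A \<inter> space M | A. A \<in> sets Mb})"

definition cond_law :: "'w measure \<Rightarrow> 'b measure \<Rightarrow> ('w \<Rightarrow> 'b) \<Rightarrow> 'w set \<Rightarrow> 'b measure" where
  "cond_law M N Z B = distr (uniform_measure M B) N Z"

definition weak_conv_at :: "('i \<Rightarrow> 'b::topological_space measure) \<Rightarrow> 'b measure \<Rightarrow> 'i filter \<Rightarrow> bool" where
  "weak_conv_at \<mu> \<nu> F \<longleftrightarrow>
     (\<forall>f::'b \<Rightarrow> real. continuous_on UNIV f \<longrightarrow> bounded (range f) \<longrightarrow>
        ((\<lambda>i. \<integral>z. f z \<partial>(\<mu> i)) \<longlongrightarrow> (\<integral>z. f z \<partial>\<nu>)) F)"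

end

theory Submission
  imports Defs
begin

text \<open>
  Write the conditional expectation of a bounded continuous \<open>f\<close> as the integral of
  \<open>F\<^sub>x(u, s)\<close>, its mean over the noise with \<open>X\<^sub>0 = u x s\<close> fixed, against the conditional law of
  \<open>(\<parallel>X\<^sub>0\<parallel> / x, X\<^sub>0 / \<parallel>X\<^sub>0\<parallel>)\<close>. For almost every noise sequence the rescaled trajectory converges to the
  trajectory of \<open>\<phi>\<close>, even while \<open>u\<close> and \<open>s\<close> move to a limit; the growth condition is needed only when the
  latter hits \<open>0\<close>. Dominated convergence thus gives \<open>F\<^sub>x \<rightarrow> F\<close> continuously, hence locally uniformly,
  so no induction over \<open>t\<close> on the level of laws is needed. Regular variation gives convergence of the
  conditional law on products of intervals and continuity sets of \<open>\<Upsilon>\<close>, and finitely many small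
  such cells carry almost all of the mass.
\<close>

text \<open>\<open>Phi\<close> is only measurable, so \<open>F\<^sub>x\<close> need not be
  continuous and weak convergence of the law of radius and direction cannot be applied to it
  directly. Convergence of \<open>F\<^sub>x\<close> at moving points takes the place of continuity:
  it makes \<open>F\<^sub>x\<close> nearly constant on a small cell for all large \<open>x\<close>,
  and it makes the limit \<open>F\<close> continuous. Such convergence has to survive iteration. The
  argument of each step has a radius and a direction dictated by the steps before, so the assumption
  on \<open>Phi\<close>, stated along curves \<open>s(x)\<close>, is recast as one joint limit in
  radius and direction, which can be composed with any radii and directions. A limit state 0 has no
  direction, and there \<open>phi\<close> says nothing. The assumption on zeros is a dichotomy:
  either linear growth holds for almost all noise and keeps negligible states negligible, or no
  direction is sent to 0 with positive probability and the limit trajectory almost surely never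
  reaches 0. Conditioning involves \<open>X0\<close> alone, so the noise keeps its law and can be
  integrated out first.\<close>

section \<open>Joint limits in radius and direction\<close>

lemma not_eventually_prod_sequencesE:
  fixes s0 :: "'a::metric_space" and P :: "real \<times> 'a \<Rightarrow> bool"
  assumes "\<not> eventually P (at_top \<times>\<^sub>F inf (nhds s0) (principal S))"
  obtains x s where "strict_mono x" "filterlim x at_top sequentially" "\<And>n. s n \<in> S"
    "s \<longlonglongrightarrow> s0" "\<And>n::nat. \<not> P (x n, s n)"
proof -
  have ex: "\<exists>a b. a \<ge> X \<and> b \<in> S \<and> dist b s0 < d \<and> \<not> P (a, b)" if "d > 0" for X d
  proof (rule ccontr)
    assume *: "\<not> ?thesis"
    have "eventually (\<lambda>b. dist b s0 < d \<and> b \<in> S) (inf (nhds s0) (principal S))"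
      using that by (auto simp: eventually_inf_principal eventually_nhds_metric)
    moreover have "eventually (\<lambda>a. a \<ge> X) at_top"
      by (rule eventually_ge_at_top)
    ultimately show False
      using assms * unfolding eventually_prod_filter by blast
  qed
  \<comment> \<open>Dependent choice, because each radius has to exceed the one before:
    counterexamples at distinct radii can later be placed on a single curve.\<close>
  have "\<exists>f. \<forall>n. (fst (f n) \<ge> real n \<and> snd (f n) \<in> S \<and> dist (snd (f n)) s0 < 1 / Suc n \<and> \<not> P (f n))
      \<and> fst (f n) < fst (f (Suc n))"
  proof (rule dependent_nat_choice)
    show "\<exists>p. fst p \<ge> real 0 \<and> snd p \<in> S \<and> dist (snd p) s0 < 1 / Suc 0 \<and> \<not> P p"
      using ex[of 1 0] by auto
    fix p :: "real \<times> 'a" and n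
    show "\<exists>q. (fst q \<ge> real (Suc n) \<and> snd q \<in> S \<and> dist (snd q) s0 < 1 / Suc (Suc n) \<and> \<not> P q)
        \<and> fst p < fst q"
      using ex[of "1 / Suc (Suc n)" "max (real (Suc n)) (fst p + 1)"] by fastforce
  qed
  then obtain f where f: "\<And>n. fst (f n) \<ge> real n" "\<And>n. snd (f n) \<in> S"
    "\<And>n. dist (snd (f n)) s0 < 1 / Suc n" "\<And>n. \<not> P (f n)" "\<And>n. fst (f n) < fst (f (Suc n))"
    by metis
  show thesis
  proof
    show "strict_mono (\<lambda>n. fst (f n))"
      using f(5) by (simp add: strict_mono_Suc_iff)
    show "filterlim (\<lambda>n. fst (f n)) at_top sequentially"
      by (rule filterlim_at_top_mono[OF filterlim_real_sequentially]) (use f(1) in auto)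
    show "(\<lambda>n. snd (f n)) \<longlonglongrightarrow> s0"
      by (rule metric_tendsto_imp_tendsto[OF LIMSEQ_inverse_real_of_nat])
        (use f(3) in \<open>auto simp: field_simps less_imp_le\<close>)
  qed (use f in auto)
qed

text \<open>Reduces the joint limit to sequences, the form in which dominated convergence is
  available for integrals over the noise.\<close>

lemma tendsto_prod_at_top_sequentiallyI:
  fixes g :: "real \<Rightarrow> 'a::metric_space \<Rightarrow> 'b::topological_space"
  assumes "\<And>x s. filterlim x at_top sequentially \<Longrightarrow> (\<And>n. s n \<in> S) \<Longrightarrow> s \<longlonglongrightarrow> s0 \<Longrightarrow>
    (\<lambda>n. g (x n) (s n)) \<longlonglongrightarrow> L"
  shows "((\<lambda>(x, s). g x s) \<longlongrightarrow> L) (at_top \<times>\<^sub>F inf (nhds s0) (principal S))"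
proof (rule topological_tendstoI, rule ccontr)
  fix U assume U: "open U" "L \<in> U"
    and "\<not> (\<forall>\<^sub>F p in at_top \<times>\<^sub>F inf (nhds s0) (principal S). (case p of (x, s) \<Rightarrow> g x s) \<in> U)"
  from not_eventually_prod_sequencesE[OF this(3)] obtain x s
    where xs: "strict_mono x" "filterlim x at_top sequentially" "\<And>n. s n \<in> S" "s \<longlonglongrightarrow> s0"
      "\<And>n::nat. g (x n) (s n) \<notin> U"
    by auto
  from topological_tendstoD[OF assms[OF xs(2-4)] U] xs(5) show False
    by simp
qed

text \<open>The hypothesis ranges over curves indexed by the radius, the form of the assumption on
  \<open>Phi\<close>. The conclusion lets radius and direction vary independently, as is needed once
  the argument of \<open>Phi\<close> is itself an earlier state.\<close>

lemma tendsto_prod_at_topI: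
  fixes g :: "real \<Rightarrow> 'a::metric_space \<Rightarrow> 'b::topological_space"
  assumes lim: "\<And>s. \<forall>x. s x \<in> S \<Longrightarrow> (s \<longlongrightarrow> s0) at_top \<Longrightarrow> ((\<lambda>x. g x (s x)) \<longlongrightarrow> L) at_top"
    and s0: "s0 \<in> S"
  shows "((\<lambda>(x, s). g x s) \<longlongrightarrow> L) (at_top \<times>\<^sub>F inf (nhds s0) (principal S))"
proof (rule topological_tendstoI, rule ccontr)
  fix U assume U: "open U" "L \<in> U"
    and "\<not> (\<forall>\<^sub>F p in at_top \<times>\<^sub>F inf (nhds s0) (principal S). (case p of (x, s) \<Rightarrow> g x s) \<in> U)"
  from not_eventually_prod_sequencesE[OF this(3)] obtain x s
    where xs: "strict_mono x" "filterlim x at_top sequentially" "\<And>n. s n \<in> S" "s \<longlonglongrightarrow> s0"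
      "\<And>n::nat. g (x n) (s n) \<notin> U"
    by auto
  \<comment> \<open>\<open>x\<close> is injective, so the bad points \<open>s n\<close> can be interpolated by one curve\<close>
  define s' where "s' y = (if y \<in> range x then s (inv x y) else s0)" for y
  have s'_x: "s' (x n) = s n" for n
    using strict_mono_imp_inj_on[OF xs(1)] by (simp add: s'_def)
  have "(s' \<longlongrightarrow> s0) at_top"
  proof (rule topological_tendstoI)
    fix V assume V: "open V" "s0 \<in> V"
    from topological_tendstoD[OF xs(4) V] obtain N where N: "\<And>n. n \<ge> N \<Longrightarrow> s n \<in> V"
      by (auto simp: eventually_sequentially)
    have "s' y \<in> V" if "y \<ge> x N" for y
    proof (cases "y \<in> range x")
      case True
      then obtain n where n: "y = x n" by auto
      with that xs(1) have "N \<le> n" by (simp add: strict_mono_less_eq)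
      with N n s'_x show ?thesis by simp
    qed (use V in \<open>simp add: s'_def\<close>)
    then show "\<forall>\<^sub>F y in at_top. s' y \<in> V"
      by (auto simp: eventually_at_top_linorder)
  qed
  moreover have "\<forall>y. s' y \<in> S"
    using xs(3) s0 by (simp add: s'_def)
  ultimately have "((\<lambda>y. g y (s' y)) \<longlongrightarrow> L) at_top"
    by (intro lim)
  from filterlim_compose[OF this xs(2)] have "(\<lambda>n. g (x n) (s n)) \<longlonglongrightarrow> L"
    by (simp add: s'_x)
  from topological_tendstoD[OF this U] xs(5) show False
    by simp
qed

lemma tendsto_product_coordinatewise:
  fixes f :: "'i \<Rightarrow> 'b \<Rightarrow> 'c::topological_space"
  assumes "\<And>j. ((\<lambda>n. f n j) \<longlongrightarrow> l j) F"
  shows "(f \<longlongrightarrow> l) F"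
proof -
  have "limitin (product_topology (\<lambda>_. euclidean) UNIV) f l F"
    using assms by (subst limitin_componentwise) auto
  then show ?thesis
    by (simp add: euclidean_product_topology)
qed

section \<open>Trajectories as functions of start and noise\<close>

text \<open>Running \<open>Xseq\<close> over a one-point sample space gives the deterministic
  trajectory, so that the randomness of the start and that of the noise can be integrated
  separately.\<close>

definition orbit :: "('a \<Rightarrow> 'e \<Rightarrow> 'a) \<Rightarrow> 'a \<Rightarrow> (nat \<Rightarrow> 'e) \<Rightarrow> nat \<Rightarrow> 'a" where
  "orbit \<Phi> y v j = Xseq \<Phi> (\<lambda>_. y) (\<lambda>i _. v i) j ()"

lemma orbit_0 [simp]: "orbit \<Phi> y v 0 = y"
  and orbit_Suc [simp]: "orbit \<Phi> y v (Suc j) = \<Phi> (orbit \<Phi> y v j) (v (Suc j))"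
  by (simp_all add: orbit_def)

lemma orbit_cong: "(\<And>i. i \<in> {1..j} \<Longrightarrow> v i = w i) \<Longrightarrow> orbit \<Phi> y v j = orbit \<Phi> y w j"
  by (induction j) auto

lemma Xseq_eq_orbit: "Xseq \<Phi> X eps j \<omega> = orbit \<Phi> (X \<omega>) (restrict (\<lambda>i. eps i \<omega>) {1..}) j"
  by (induction j) auto

lemma measurable_orbit:
  assumes \<Phi>: "(\<lambda>(y, e). \<Phi> y e) \<in> borel \<Otimes>\<^sub>M E \<rightarrow>\<^sub>M borel" and "{1..j} \<subseteq> I"
  shows "(\<lambda>(y, v). orbit \<Phi> y v j) \<in> borel \<Otimes>\<^sub>M PiM I (\<lambda>_. E) \<rightarrow>\<^sub>M borel"
  using assms(2)
proof (induction j)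
  case (Suc j)
  have [measurable]: "(\<lambda>p. orbit \<Phi> (fst p) (snd p) j) \<in> borel \<Otimes>\<^sub>M PiM I (\<lambda>_. E) \<rightarrow>\<^sub>M borel"
    using Suc.IH Suc.prems by (auto simp: case_prod_unfold atLeastAtMostSuc_conv)
  have [measurable]: "(\<lambda>p. snd p (Suc j)) \<in> borel \<Otimes>\<^sub>M PiM I (\<lambda>_. E) \<rightarrow>\<^sub>M E"
    using Suc.prems by (intro measurable_compose[OF measurable_snd] measurable_component_singleton) auto
  have "(\<lambda>p. (\<lambda>(y, e). \<Phi> y e) (orbit \<Phi> (fst p) (snd p) j, snd p (Suc j)))
      \<in> borel \<Otimes>\<^sub>M PiM I (\<lambda>_. E) \<rightarrow>\<^sub>M borel"
    by (rule measurable_compose[OF _ \<Phi>]) measurable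
  then show ?case
    by (simp add: case_prod_unfold)
qed (simp add: case_prod_unfold)

lemma phi_ext_0 [simp]: "phi_ext phi 0 e = 0"
  by (simp add: phi_ext_def)

lemma measurable_phi_ext:
  fixes phi :: "'a::euclidean_space \<Rightarrow> 'e \<Rightarrow> 'a"
  assumes "(\<lambda>(s, e). phi s e) \<in> restrict_space borel (sphere 0 1) \<Otimes>\<^sub>M E \<rightarrow>\<^sub>M borel"
  shows "(\<lambda>(v, e). phi_ext phi v e) \<in> borel \<Otimes>\<^sub>M E \<rightarrow>\<^sub>M borel"
proof -
  obtain b :: 'a where b: "b \<in> Basis" using nonempty_Basis by blast
  \<comment> \<open>\<open>phi\<close> is measurable on the sphere only, so 0 is given a fixed unit
    vector as its direction; the factor \<open>norm v\<close> removes the effect of this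
    choice.\<close>
  define dir where "dir v = (if v = 0 then b else v /\<^sub>R norm v)" for v
  have [measurable]: "dir \<in> borel \<rightarrow>\<^sub>M restrict_space borel (sphere 0 1)"
  proof (rule measurable_restrict_space2)
    show "dir \<in> borel_measurable borel"
      unfolding dir_def by measurable
  qed (use b in \<open>auto simp: dir_def\<close>)
  have eq: "phi_ext phi v e = norm v *\<^sub>R phi (dir v) e" for v e
    by (simp add: phi_ext_def dir_def)
  have [measurable]: "(\<lambda>p. (\<lambda>(s, e). phi s e) (dir (fst p), snd p)) \<in> borel \<Otimes>\<^sub>M E \<rightarrow>\<^sub>M borel"
    by (rule measurable_compose[OF _ assms]) measurable
  show ?thesis
    using \<open>(\<lambda>p. (\<lambda>(s, e). phi s e) (dir (fst p), snd p)) \<in> _\<close> unfolding eq case_prod_unfold by simp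
qed

section \<open>Pathwise convergence of rescaled trajectories\<close>

definition linear_growth :: "('a::real_normed_vector \<Rightarrow> 'a) \<Rightarrow> bool" where
  "linear_growth h \<longleftrightarrow> (\<exists>C. \<forall>\<^sub>F x in at_top. \<forall>y. norm y \<le> x \<longrightarrow> norm (h y) \<le> C * x)"

text \<open>States that are negligible against \<open>r\<close> may still be unbounded and point
  anywhere, so no limit along directions applies. Eventually they lie within radius
  \<open>\<delta> * r n\<close>, and the growth bound at that radius is a small multiple of
  \<open>r n\<close>.\<close>

lemma tendsto_zero_linear_growth:
  assumes h: "linear_growth h" and r: "filterlim r at_top F"
    and z: "((\<lambda>n. z n /\<^sub>R r n) \<longlongrightarrow> 0) F"
  shows "((\<lambda>n. h (z n) /\<^sub>R r n) \<longlongrightarrow> 0) F"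
proof (rule tendstoI)
  fix \<epsilon> :: real assume "\<epsilon> > 0"
  obtain C where C: "\<forall>\<^sub>F x in at_top. \<forall>y. norm y \<le> x \<longrightarrow> norm (h y) \<le> C * x"
    using h unfolding linear_growth_def by blast
  \<comment> \<open>The sign of \<open>C\<close> is unknown; \<open>\<bar>C\<bar> + 1\<close> keeps
    \<open>\<delta>\<close> positive and makes \<open>C * \<delta> < \<epsilon>\<close>
    strict.\<close>
  define \<delta> where "\<delta> = \<epsilon> / (\<bar>C\<bar> + 1)"
  have \<delta>: "\<delta> > 0" using \<open>\<epsilon> > 0\<close> by (simp add: \<delta>_def)
  have "C * \<delta> \<le> \<bar>C\<bar> * \<delta>"
    using \<delta> by (intro mult_right_mono) auto
  also have "\<dots> < (\<bar>C\<bar> + 1) * \<delta>"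
    using \<delta> by (intro mult_strict_right_mono) auto
  also have "\<dots> = \<epsilon>" by (simp add: \<delta>_def)
  finally have C\<delta>: "C * \<delta> < \<epsilon>" .
  have "filterlim (\<lambda>n. \<delta> * r n) at_top F"
    by (rule filterlim_tendsto_pos_mult_at_top[OF tendsto_const \<delta> r])
  from eventually_compose_filterlim[OF C this] tendstoD[OF z \<delta>] filterlim_at_top_dense[THEN iffD1, OF r, rule_format, of 0]
  show "\<forall>\<^sub>F n in F. dist (h (z n) /\<^sub>R r n) 0 < \<epsilon>"
  proof eventually_elim
    case (elim n)
    then have "norm (z n) \<le> \<delta> * r n"
      by (simp add: field_simps)
    with elim have "norm (h (z n)) \<le> C * \<delta> * r n" by (simp add: ac_simps)
    also have "\<dots> < \<epsilon> * r n" using C\<delta> elim by simp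
    finally show ?case using elim by (simp add: field_simps)
  qed
qed

text \<open>Since \<open>m \<noteq> 0\<close>, the norm of \<open>z\<close> tends to infinity and
  its direction to that of \<open>m\<close>, so the joint limit applies with
  \<open>norm (z n)\<close> as radius. Returning to the scale \<open>r n\<close> multiplies by
  \<open>norm (z n) / r n\<close>, which tends to \<open>norm m\<close>.\<close>

lemma tendsto_scaled_step:
  fixes h g :: "'a::real_normed_vector \<Rightarrow> 'a"
  assumes lim: "((\<lambda>(x, s). h (x *\<^sub>R s) /\<^sub>R x) \<longlongrightarrow> g (m /\<^sub>R norm m))
        (at_top \<times>\<^sub>F inf (nhds (m /\<^sub>R norm m)) (principal (sphere 0 1)))"
    and m: "m \<noteq> 0" and r: "filterlim r at_top F"
    and z: "((\<lambda>n. z n /\<^sub>R r n) \<longlongrightarrow> m) F"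
  shows "((\<lambda>n. h (z n) /\<^sub>R r n) \<longlongrightarrow> norm m *\<^sub>R g (m /\<^sub>R norm m)) F"
proof -
  have rpos: "\<forall>\<^sub>F n in F. r n > 0"
    using r by (simp add: filterlim_at_top_dense)
  have norm_z: "((\<lambda>n. norm (z n /\<^sub>R r n)) \<longlongrightarrow> norm m) F"
    by (intro tendsto_intros z)
  from m have "\<forall>\<^sub>F n in F. z n /\<^sub>R r n \<noteq> 0"
    by (rule tendsto_imp_eventually_ne[OF z])
  then have znz: "\<forall>\<^sub>F n in F. z n \<noteq> 0"
    by eventually_elim auto
  have "filterlim (\<lambda>n. norm (z n /\<^sub>R r n) * r n) at_top F"
    using m by (intro filterlim_tendsto_pos_mult_at_top[OF norm_z _ r]) simp
  then have top: "filterlim (\<lambda>n. norm (z n)) at_top F"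
    by (rule filterlim_cong[THEN iffD1, OF refl refl, rotated])
      (use rpos in \<open>eventually_elim, auto\<close>)
  have "((\<lambda>n. (z n /\<^sub>R r n) /\<^sub>R norm (z n /\<^sub>R r n)) \<longlongrightarrow> m /\<^sub>R norm m) F"
    using m by (intro tendsto_intros z) auto
  then have "((\<lambda>n. z n /\<^sub>R norm (z n)) \<longlongrightarrow> m /\<^sub>R norm m) F"
    by (rule filterlim_cong[THEN iffD1, OF refl refl, rotated])
      (use rpos in \<open>eventually_elim, auto\<close>)
  moreover have "\<forall>\<^sub>F n in F. z n /\<^sub>R norm (z n) \<in> sphere 0 1"
    using znz by eventually_elim auto
  ultimately have dir: "filterlim (\<lambda>n. z n /\<^sub>R norm (z n))
      (inf (nhds (m /\<^sub>R norm m)) (principal (sphere 0 1))) F"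
    by (simp add: filterlim_inf filterlim_principal)
  from filterlim_compose[OF lim filterlim_Pair[OF top dir]]
  have "((\<lambda>n. h (norm (z n) *\<^sub>R (z n /\<^sub>R norm (z n))) /\<^sub>R norm (z n)) \<longlongrightarrow> g (m /\<^sub>R norm m)) F"
    by (simp only: case_prod_conv)
  with norm_z have "((\<lambda>n. norm (z n /\<^sub>R r n) *\<^sub>R (h (norm (z n) *\<^sub>R (z n /\<^sub>R norm (z n))) /\<^sub>R norm (z n)))
      \<longlongrightarrow> norm m *\<^sub>R g (m /\<^sub>R norm m)) F"
    by (rule tendsto_scaleR)
  then show ?thesis
    by (rule filterlim_cong[THEN iffD1, OF refl refl, rotated])
      (use rpos znz in \<open>eventually_elim, auto\<close>)
qed

text \<open>The induction runs along one fixed noise sequence. A nonzero limit state has a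
  direction, at which the joint limit is used; at a zero limit state the growth bound replaces it,
  hence the conditional form of \<open>growth\<close>.\<close>

lemma tendsto_orbit:
  assumes lim: "\<And>i s. i \<ge> 1 \<Longrightarrow> s \<in> sphere 0 1 \<Longrightarrow>
      ((\<lambda>(x, s). \<Phi> (x *\<^sub>R s) (v i) /\<^sub>R x) \<longlongrightarrow> \<phi> s (v i))
        (at_top \<times>\<^sub>F inf (nhds s) (principal (sphere 0 1)))"
    and growth: "\<And>i. orbit (phi_ext \<phi>) s0 v i = 0 \<Longrightarrow> linear_growth (\<lambda>y. \<Phi> y (v (Suc i)))"
    and r: "filterlim r at_top F" and s: "(s \<longlongrightarrow> s0) F"
  shows "((\<lambda>n. orbit \<Phi> (r n *\<^sub>R s n) v j /\<^sub>R r n) \<longlongrightarrow> orbit (phi_ext \<phi>) s0 v j) F"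
proof (induction j)
  case 0
  have "\<forall>\<^sub>F n in F. r n > 0"
    using r by (simp add: filterlim_at_top_dense)
  then have "\<forall>\<^sub>F n in F. s n = (r n *\<^sub>R s n) /\<^sub>R r n"
    by eventually_elim simp
  with s show ?case
    by (simp add: tendsto_cong)
next
  case (Suc j)
  show ?case
  proof (cases "orbit (phi_ext \<phi>) s0 v j = 0")
    case True
    with tendsto_zero_linear_growth[OF growth[OF True] r] Suc show ?thesis
      by simp
  next
    case False
    let ?m = "orbit (phi_ext \<phi>) s0 v j"
    have "((\<lambda>(x, s). \<Phi> (x *\<^sub>R s) (v (Suc j)) /\<^sub>R x) \<longlongrightarrow> \<phi> (?m /\<^sub>R norm ?m) (v (Suc j)))
        (at_top \<times>\<^sub>F inf (nhds (?m /\<^sub>R norm ?m)) (principal (sphere 0 1)))"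
      using False by (intro lim) auto
    from tendsto_scaled_step[where g="\<lambda>s. \<phi> s (v (Suc j))", OF this False r Suc] False
    show ?thesis
      unfolding orbit_Suc phi_ext_def[of \<phi> ?m] by simp
  qed
qed

section \<open>Convergence of integrals from regular variation\<close>

text \<open>On the cells the step function errs by at most \<open>\<epsilon>\<close>; off them it is
  0 and errs by at most \<open>C\<close>, and the mass there is what the cells leave over.\<close>

lemma (in prob_space) integral_step_approx:
  fixes h :: "'a \<Rightarrow> real" and A :: "'i \<Rightarrow> 'a set"
  assumes I: "finite I" and disj: "disjoint_family_on A I" and A: "\<And>i. i \<in> I \<Longrightarrow> A i \<in> events"
    and h: "h \<in> borel_measurable M" and C: "\<And>z. \<bar>h z\<bar> \<le> C"
    and close: "\<And>i z. i \<in> I \<Longrightarrow> z \<in> A i \<Longrightarrow> \<bar>h z - c i\<bar> \<le> \<epsilon>" and \<epsilon>: "\<epsilon> \<ge> 0"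
  shows "\<bar>(\<integral>z. h z \<partial>M) - (\<Sum>i\<in>I. c i * prob (A i))\<bar> \<le> \<epsilon> + C * (1 - (\<Sum>i\<in>I. prob (A i)))"
proof -
  note [measurable] = h A
  define ind :: "'i \<Rightarrow> 'a \<Rightarrow> real" where "ind i = indicator (A i)" for i
  have int_ind: "integrable M (ind i)" if "i \<in> I" for i
    using A[OF that] by (auto simp: ind_def less_top[symmetric])
  have int_step: "integrable M (\<lambda>z. \<Sum>i\<in>I. d i * ind i z)" for d :: "'i \<Rightarrow> real"
    using int_ind by auto
  have integral_step: "(\<integral>z. (\<Sum>i\<in>I. d i * ind i z) \<partial>M) = (\<Sum>i\<in>I. d i * prob (A i))" for d :: "'i \<Rightarrow> real"
    using int_ind A by (subst Bochner_Integration.integral_sum) (auto simp: ind_def)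
  have int_h: "integrable M h"
    by (rule integrable_const_bound[of _ C]) (use C h in auto)
  have int_1: "integrable M (\<lambda>z. \<Sum>i\<in>I. ind i z)"
    using int_step[of "\<lambda>_. 1"] by simp
  have ptw: "\<bar>h z - (\<Sum>i\<in>I. c i * ind i z)\<bar> \<le> \<epsilon> + C * (1 - (\<Sum>i\<in>I. ind i z))" for z
  proof (cases "\<exists>i\<in>I. z \<in> A i")
    case True
    then obtain i where i: "i \<in> I" "z \<in> A i" by blast
    have ind: "ind j z = (if j = i then 1 else 0)" if "j \<in> I" for j
      using i that disj by (auto simp: ind_def disjoint_family_on_def indicator_def)
    have "(\<Sum>j\<in>I. d j * ind j z) = (\<Sum>j\<in>I. if j = i then d j else 0)" for d :: "'i \<Rightarrow> real"
      by (intro sum.cong) (auto simp: ind)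
    then have "(\<Sum>j\<in>I. d j * ind j z) = d i" for d :: "'i \<Rightarrow> real"
      using I i by simp
    from this[of c] this[of "\<lambda>_. 1"] show ?thesis
      using close[OF i] by simp
  next
    case False
    then have "ind i z = 0" if "i \<in> I" for i
      using that by (auto simp: ind_def)
    with C[of z] \<epsilon> show ?thesis by simp
  qed
  have "\<bar>(\<integral>z. h z \<partial>M) - (\<Sum>i\<in>I. c i * prob (A i))\<bar> = \<bar>\<integral>z. h z - (\<Sum>i\<in>I. c i * ind i z) \<partial>M\<bar>"
    using int_h int_step by (subst Bochner_Integration.integral_diff) (auto simp: integral_step)
  also have "\<dots> \<le> (\<integral>z. \<bar>h z - (\<Sum>i\<in>I. c i * ind i z)\<bar> \<partial>M)"
    by (rule integral_abs_bound)
  also have "\<dots> \<le> (\<integral>z. \<epsilon> + C * (1 - (\<Sum>i\<in>I. ind i z)) \<partial>M)"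
    using int_h int_step int_1 ptw by (intro integral_mono) auto
  also have "\<dots> = \<epsilon> + C * (1 - (\<Sum>i\<in>I. prob (A i)))"
    using int_1 integral_step[of "\<lambda>_. 1"] by (simp add: prob_space)
  finally show ?thesis .
qed

text \<open>The values \<open>c\<close> do not depend on \<open>x\<close>, so \<open>h x\<close>
  under \<open>\<mu> x\<close> and \<open>g\<close> under \<open>\<nu>\<close> are compared with the
  same step function, and only finitely many weights have to converge. Their convergence also bounds
  the mass of \<open>\<mu> x\<close> off the cells, which is where tightness comes from.\<close>

lemma tendsto_integral_step_approx:
  fixes \<mu> :: "'x \<Rightarrow> 'z measure" and h :: "'x \<Rightarrow> 'z \<Rightarrow> real"
  assumes \<mu>: "\<forall>\<^sub>F x in F. prob_space (\<mu> x)" "\<And>x. sets (\<mu> x) = sets \<nu>" and \<nu>: "prob_space \<nu>"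
    and h: "\<And>x. h x \<in> borel_measurable \<nu>" "\<And>x z. \<bar>h x z\<bar> \<le> C"
    and g: "g \<in> borel_measurable \<nu>" "\<And>z. \<bar>g z\<bar> \<le> C"
    and cells: "\<And>\<epsilon>. \<epsilon> > 0 \<Longrightarrow> \<exists>(I :: 'i set) A c. finite I \<and> disjoint_family_on A I \<and> (\<forall>i\<in>I. A i \<in> sets \<nu>) \<and>
      1 - (\<Sum>i\<in>I. measure \<nu> (A i)) \<le> \<epsilon> \<and>
      (\<forall>i\<in>I. ((\<lambda>x. measure (\<mu> x) (A i)) \<longlongrightarrow> measure \<nu> (A i)) F) \<and>
      (\<forall>i\<in>I. \<forall>z\<in>A i. \<bar>g z - c i\<bar> \<le> \<epsilon>) \<and>
      (\<forall>i\<in>I. \<forall>\<^sub>F x in F. \<forall>z\<in>A i. \<bar>h x z - c i\<bar> \<le> \<epsilon>)"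
  shows "((\<lambda>x. \<integral>z. h x z \<partial>\<mu> x) \<longlongrightarrow> (\<integral>z. g z \<partial>\<nu>)) F"
proof (rule tendstoI)
  fix e :: real assume "e > 0"
  have C: "C \<ge> 0" using g(2) by (meson abs_ge_zero order_trans)
  \<comment> \<open>Each of \<open>g\<close> and \<open>h x\<close> costs \<open>\<epsilon>\<close>
    on the cells and, in the limit, at most \<open>C * \<epsilon>\<close> off them, which makes
    \<open>(2 + 2 * C) * \<epsilon>\<close> in total; the further factor 2 gives strictness.\<close>
  define \<epsilon> where "\<epsilon> = e / (2 * (2 + 2 * C))"
  have \<epsilon>: "\<epsilon> > 0" "(2 + 2 * C) * \<epsilon> < e"
    using \<open>e > 0\<close> C by (auto simp: \<epsilon>_def field_simps add_pos_nonneg)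
  from cells[OF \<epsilon>(1)] obtain I :: "'i set" and A c where I: "finite I" "disjoint_family_on A I"
    and A: "\<And>i. i \<in> I \<Longrightarrow> A i \<in> sets \<nu>"
    and rest: "1 - (\<Sum>i\<in>I. measure \<nu> (A i)) \<le> \<epsilon>"
    and lim: "\<And>i. i \<in> I \<Longrightarrow> ((\<lambda>x. measure (\<mu> x) (A i)) \<longlongrightarrow> measure \<nu> (A i)) F"
    and close_g: "\<And>i z. i \<in> I \<Longrightarrow> z \<in> A i \<Longrightarrow> \<bar>g z - c i\<bar> \<le> \<epsilon>"
    and close_h: "\<And>i. i \<in> I \<Longrightarrow> \<forall>\<^sub>F x in F. \<forall>z\<in>A i. \<bar>h x z - c i\<bar> \<le> \<epsilon>"
    by (elim exE conjE) blast
  define s where "s x = (\<Sum>i\<in>I. c i * measure (\<mu> x) (A i))" for x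
  define p where "p x = (\<Sum>i\<in>I. measure (\<mu> x) (A i))" for x
  define s0 where "s0 = (\<Sum>i\<in>I. c i * measure \<nu> (A i))"
  define p0 where "p0 = (\<Sum>i\<in>I. measure \<nu> (A i))"
  have g_s0: "\<bar>(\<integral>z. g z \<partial>\<nu>) - s0\<bar> \<le> \<epsilon> + C * (1 - p0)"
    unfolding s0_def p0_def
    by (rule prob_space.integral_step_approx[OF \<nu> I A g close_g]) (use \<epsilon> in auto)
  have "((\<lambda>x. \<epsilon> + C * (1 - p x) + \<bar>s x - s0\<bar> + (\<epsilon> + C * (1 - p0)))
      \<longlongrightarrow> \<epsilon> + C * (1 - p0) + \<bar>s0 - s0\<bar> + (\<epsilon> + C * (1 - p0))) F"
    unfolding s_def p_def s0_def p0_def by (intro tendsto_intros lim)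
  moreover have "C * (1 - p0) \<le> C * \<epsilon>"
    using C rest by (intro mult_left_mono) (auto simp: p0_def)
  then have "\<epsilon> + C * (1 - p0) + \<bar>s0 - s0\<bar> + (\<epsilon> + C * (1 - p0)) < e"
    using \<epsilon>(2) by (simp add: algebra_simps)
  ultimately have small: "\<forall>\<^sub>F x in F. \<epsilon> + C * (1 - p x) + \<bar>s x - s0\<bar> + (\<epsilon> + C * (1 - p0)) < e"
    by (rule order_tendstoD)
  have "\<forall>\<^sub>F x in F. \<forall>i\<in>I. \<forall>z\<in>A i. \<bar>h x z - c i\<bar> \<le> \<epsilon>"
    using I close_h by (intro eventually_ball_finite) auto
  with \<mu>(1) small show "\<forall>\<^sub>F x in F. dist (\<integral>z. h x z \<partial>\<mu> x) (\<integral>z. g z \<partial>\<nu>) < e"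
  proof eventually_elim
    case (elim x)
    have "\<bar>(\<integral>z. h x z \<partial>\<mu> x) - s x\<bar> \<le> \<epsilon> + C * (1 - p x)"
      unfolding s_def p_def
      by (rule prob_space.integral_step_approx[OF elim(1) I])
        (use elim \<epsilon> h A \<mu>(2) in \<open>auto simp: measurable_cong_sets[OF \<mu>(2) refl]\<close>)
    with g_s0 elim(2) show ?case
      unfolding dist_real_def by linarith
  qed
qed

text \<open>Regular variation is tested only on sets whose frontier within the sphere is a null set,
  so the fine pieces have to be of this kind. They are cut out by balls bounded by null spheres;
  finite unions and differences create no frontier outside these spheres.\<close>

lemma null_frontier_partition:
  fixes \<Upsilon> :: "'a::euclidean_space measure"
  assumes \<Upsilon>: "finite_measure \<Upsilon>" "sets \<Upsilon> = sets borel" and S: "compact S" and d: "d > 0"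
  obtains \<P> where "finite \<P>" "disjoint \<P>" "\<Union>\<P> = S" "\<And>T. T \<in> \<P> \<Longrightarrow> T \<in> sets borel"
    "\<And>T. T \<in> \<P> \<Longrightarrow> measure \<Upsilon> (subtopology euclidean S frontier_of T) = 0"
    "\<And>T x y. T \<in> \<P> \<Longrightarrow> x \<in> T \<Longrightarrow> y \<in> T \<Longrightarrow> dist x y < d"
proof -
  interpret finite_measure \<Upsilon> by fact
  note [measurable_cong] = \<Upsilon>(2)
  let ?fr = "\<lambda>T. subtopology euclidean S frontier_of T"
  have fr_sets: "?fr T \<in> sets \<Upsilon>" for T
  proof -
    have "closed (?fr T)"
      using closedin_frontier_of[of "top_of_set S" T] compact_imp_closed[OF S]
      by (simp add: closedin_closed_eq)
    then show ?thesis using \<Upsilon>(2) by simp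
  qed
  \<comment> \<open>the spheres around \<open>c\<close> are disjoint, so all but countably many of them are null sets\<close>
  have "\<exists>r. 0 < r \<and> r < d / 2 \<and> measure \<Upsilon> (sphere c r) = 0" for c
  proof -
    interpret D: finite_measure "distr \<Upsilon> borel (dist c)"
      by (rule finite_measure_distr) measurable
    obtain r where r: "r \<in> {0<..<d/2}" "r \<notin> {r. measure (distr \<Upsilon> borel (dist c)) {r} \<noteq> 0}"
      using open_minus_countable[OF D.countable_support, of "{0<..<d/2}"] d by auto
    moreover have "dist c -` {r} \<inter> space \<Upsilon> = sphere c r"
      using sets_eq_imp_space_eq[OF \<Upsilon>(2)] by auto
    ultimately show ?thesis
      by (intro exI[of _ r]) (auto simp: measure_distr)
  qed
  then obtain r where r: "\<And>c. 0 < r c" "\<And>c. r c < d / 2" "\<And>c. measure \<Upsilon> (sphere c (r c)) = 0"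
    by metis
  have ball_null: "?fr (S \<inter> ball c (r c)) \<in> null_sets \<Upsilon>" for c
  proof (rule null_sets_subset[OF _ fr_sets])
    show "sphere c (r c) \<in> null_sets \<Upsilon>"
      using r(3)[of c] \<Upsilon>(2) by (auto simp: null_sets_def emeasure_eq_measure)
    have "?fr (S \<inter> ball c (r c)) = ?fr (ball c (r c))"
      by (subst (2) frontier_of_restrict) simp
    also have "\<dots> \<subseteq> frontier (ball c (r c))"
      using frontier_of_subtopology_subset[of S euclidean "ball c (r c)"]
        frontier_of_subset_subtopology[of euclidean S "ball c (r c)"] by auto
    also have "\<dots> = sphere c (r c)"
      using r(1) by simp
    finally show "?fr (S \<inter> ball c (r c)) \<subseteq> sphere c (r c)" .
  qed
  obtain C where C: "finite C" "S \<subseteq> (\<Union>c\<in>C. ball c (r c))"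
  proof (rule compactE_image[OF S, of S "\<lambda>c. ball c (r c)"])
    show "S \<subseteq> (\<Union>c\<in>S. ball c (r c))"
      using r(1) by force
  qed auto
  have "\<exists>\<P>. finite \<P> \<and> disjoint \<P> \<and> \<Union>\<P> = S \<inter> (\<Union>c\<in>C. ball c (r c)) \<and> (\<forall>T\<in>\<P>. T \<in> sets borel \<and>
      ?fr T \<in> null_sets \<Upsilon> \<and> (\<exists>c. T \<subseteq> ball c (r c)))"
    using C(1)
  proof (induction C)
    case empty
    show ?case by (intro exI[of _ "{}"]) auto
  next
    case (insert c C)
    then obtain \<P> where \<P>: "finite \<P>" "disjoint \<P>" "\<Union>\<P> = S \<inter> (\<Union>c\<in>C. ball c (r c))"
      "\<And>T. T \<in> \<P> \<Longrightarrow> T \<in> sets borel" "\<And>T. T \<in> \<P> \<Longrightarrow> ?fr T \<in> null_sets \<Upsilon>"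
      "\<And>T. T \<in> \<P> \<Longrightarrow> \<exists>c. T \<subseteq> ball c (r c)"
      by auto
    \<comment> \<open>Only the part that the new ball adds. Its frontier lies in that of the ball
      together with those of the finitely many earlier pieces, and so is null.\<close>
    let ?T = "S \<inter> ball c (r c) - \<Union>\<P>"
    have "?fr ?T \<subseteq> ?fr (S \<inter> ball c (r c)) \<union> ?fr (\<Union>\<P>)"
    proof -
      have "?T = S \<inter> ball c (r c) \<inter> (topspace (top_of_set S) - \<Union>\<P>)" by auto
      then show ?thesis
        using frontier_of_Int_subset[of "top_of_set S" "S \<inter> ball c (r c)" "topspace (top_of_set S) - \<Union>\<P>"]
        by (simp only: frontier_of_complement)
    qed
    also have "\<dots> \<subseteq> ?fr (S \<inter> ball c (r c)) \<union> (\<Union>T\<in>\<P>. ?fr T)"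
      using frontier_of_Union_subset[OF \<P>(1), of "top_of_set S"] by auto
    finally have "?fr ?T \<in> null_sets \<Upsilon>"
      by (rule null_sets_subset[rotated 2])
        (use \<P> ball_null fr_sets in \<open>auto intro!: null_sets.Un null_sets.finite_UN\<close>)
    moreover have "?T \<in> sets borel"
      using \<P>(1,4) compact_imp_closed[OF S]
      by (intro sets.Diff sets.Int sets.finite_Union borel_closed borel_open) auto
    moreover have "\<Union>(insert ?T \<P>) = S \<inter> (\<Union>c\<in>insert c C. ball c (r c))"
      using \<P>(3) by auto
    moreover have "disjoint (insert ?T \<P>)"
      using \<P>(2) by (auto simp: disjoint_def pairwise_def disjnt_def)
    ultimately show ?case
      using \<P>(1,4-6) by (intro exI[of _ "insert ?T \<P>"]) auto
  qed
  then obtain \<P> where \<P>: "finite \<P>" "disjoint \<P>" "\<Union>\<P> = S"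
    "\<And>T. T \<in> \<P> \<Longrightarrow> T \<in> sets borel" "\<And>T. T \<in> \<P> \<Longrightarrow> ?fr T \<in> null_sets \<Upsilon>"
    "\<And>T. T \<in> \<P> \<Longrightarrow> \<exists>c. T \<subseteq> ball c (r c)"
    using C(2) by (auto simp: Int_absorb2)
  have "dist x y < d" if T: "T \<in> \<P>" "x \<in> T" "y \<in> T" for T x y
  proof -
    obtain c where "dist c x < r c" "dist c y < r c"
      using \<P>(6)[OF T(1)] T(2,3) by (auto simp: subset_iff)
    then show ?thesis
      using r(2)[of c] dist_triangle2[of x y c] by (simp add: dist_commute)
  qed
  moreover have "measure \<Upsilon> (?fr T) = 0" if "T \<in> \<P>" for T
    using \<P>(5)[OF that] by (simp add: measure_eq_0_null_sets)
  ultimately show ?thesis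
    using that[OF \<P>(1-4)] by blast
qed

lemma dist_Pair_le: "dist (a, b) (c, d) \<le> dist a c + dist b d"
  unfolding dist_Pair_Pair by (rule sqrt_sum_squares_le_sum) auto

text \<open>Radii are cut off at some \<open>K\<close> beyond which the limit law has mass less than
  \<open>\<epsilon>\<close>. On the compact remainder a Lebesgue number tells how fine the cells
  must be for one constant per cell to serve both \<open>g\<close> and all late
  \<open>h x\<close>.\<close>

lemma tendsto_integral_regular_variation:
  fixes \<mu> :: "real \<Rightarrow> (real \<times> 'a::euclidean_space) measure" and h :: "real \<Rightarrow> real \<times> 'a \<Rightarrow> real"
  assumes \<mu>: "\<forall>\<^sub>F x in at_top. prob_space (\<mu> x)" "\<And>x. sets (\<mu> x) = sets borel"
    and \<nu>: "prob_space \<nu>" "sets \<nu> = sets borel"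
    and \<Upsilon>: "finite_measure \<Upsilon>" "sets \<Upsilon> = sets borel" "measure \<Upsilon> S = 1"
    and S: "compact S" and \<alpha>: "\<alpha> > 0"
    and \<mu>_rect: "\<And>a b T. 1 \<le> a \<Longrightarrow> a \<le> b \<Longrightarrow> T \<in> sets borel \<Longrightarrow> T \<subseteq> S \<Longrightarrow>
        measure \<Upsilon> (subtopology euclidean S frontier_of T) = 0 \<Longrightarrow>
        ((\<lambda>x. measure (\<mu> x) ({a<..b} \<times> T)) \<longlongrightarrow> (a powr - \<alpha> - b powr - \<alpha>) * measure \<Upsilon> T) at_top"
    and \<nu>_rect: "\<And>a b T. 1 \<le> a \<Longrightarrow> a \<le> b \<Longrightarrow> T \<in> sets borel \<Longrightarrow>
        measure \<nu> ({a<..b} \<times> T) = (a powr - \<alpha> - b powr - \<alpha>) * measure \<Upsilon> T"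
    and h: "\<And>x. h x \<in> borel_measurable borel" "\<And>x z. \<bar>h x z\<bar> \<le> C"
    and g: "g \<in> borel_measurable borel" "\<And>z. \<bar>g z\<bar> \<le> C"
    and lim: "\<And>z. z \<in> {1..} \<times> S \<Longrightarrow>
        ((\<lambda>(x, z). h x z) \<longlongrightarrow> g z) (at_top \<times>\<^sub>F inf (nhds z) (principal ({1..} \<times> S)))"
  shows "((\<lambda>x. \<integral>z. h x z \<partial>\<mu> x) \<longlongrightarrow> (\<integral>z. g z \<partial>\<nu>)) at_top"
proof -
  let ?D = "{1..} \<times> S"
  \<comment> \<open>The joint limit at \<open>z0\<close> gives one neighbourhood and one threshold
    on which \<open>g z0\<close> approximates every \<open>h x\<close>. Letting \<open>x\<close>
    grow with the point held fixed transfers the bound to \<open>g\<close>, so continuity of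
    \<open>g\<close> on the domain is a consequence.\<close>
  have local: "\<exists>U X. open U \<and> z0 \<in> U \<and> (\<forall>x\<ge>X. \<forall>z\<in>U \<inter> ?D. \<bar>h x z - g z0\<bar> \<le> \<epsilon>) \<and>
      (\<forall>z\<in>U \<inter> ?D. \<bar>g z - g z0\<bar> \<le> \<epsilon>)" if z0: "z0 \<in> ?D" and "\<epsilon> > 0" for z0 \<epsilon>
  proof -
    from tendstoD[OF lim[OF z0] \<open>\<epsilon> > 0\<close>] obtain P Q where
      P: "eventually P at_top" and Q: "eventually Q (inf (nhds z0) (principal ?D))"
      and PQ: "\<And>x z. P x \<Longrightarrow> Q z \<Longrightarrow> dist (h x z) (g z0) < \<epsilon>"
      unfolding eventually_prod_filter by auto
    from P obtain X where X: "\<And>x. x \<ge> X \<Longrightarrow> P x"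
      by (auto simp: eventually_at_top_linorder)
    from Q obtain U where U: "open U" "z0 \<in> U" "\<And>z. z \<in> U \<inter> ?D \<Longrightarrow> Q z"
      by (auto simp: eventually_inf_principal eventually_nhds)
    have hU: "\<bar>h x z - g z0\<bar> \<le> \<epsilon>" if "x \<ge> X" "z \<in> U \<inter> ?D" for x z
      using PQ[OF X[OF that(1)] U(3)[OF that(2)]] by (simp add: dist_real_def)
    have "\<bar>g z - g z0\<bar> \<le> \<epsilon>" if z: "z \<in> U \<inter> ?D" for z
    proof (rule tendsto_upperbound)
      have "filterlim (\<lambda>_. z) (inf (nhds z) (principal ?D)) at_top"
        using z by (auto simp: filterlim_inf filterlim_principal)
      from filterlim_compose[OF lim filterlim_Pair[OF filterlim_ident this]] z
      have "((\<lambda>x. h x z) \<longlongrightarrow> g z) at_top" by simp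
      then show "((\<lambda>x. \<bar>h x z - g z0\<bar>) \<longlongrightarrow> \<bar>g z - g z0\<bar>) at_top"
        by (intro tendsto_intros)
      show "\<forall>\<^sub>F x in at_top. \<bar>h x z - g z0\<bar> \<le> \<epsilon>"
        using hU z by (auto simp: eventually_at_top_linorder)
    qed auto
    with U hU show ?thesis by blast
  qed
  have cells: "\<exists>(I :: (nat \<times> 'a set) set) A c. finite I \<and> disjoint_family_on A I \<and> (\<forall>i\<in>I. A i \<in> sets \<nu>) \<and>
      1 - (\<Sum>i\<in>I. measure \<nu> (A i)) \<le> \<epsilon> \<and>
      (\<forall>i\<in>I. ((\<lambda>x. measure (\<mu> x) (A i)) \<longlongrightarrow> measure \<nu> (A i)) at_top) \<and>
      (\<forall>i\<in>I. \<forall>z\<in>A i. \<bar>g z - c i\<bar> \<le> \<epsilon>) \<and>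
      (\<forall>i\<in>I. \<forall>\<^sub>F x in at_top. \<forall>z\<in>A i. \<bar>h x z - c i\<bar> \<le> \<epsilon>)" if "\<epsilon> > 0" for \<epsilon>
  proof -
    have "((\<lambda>K::real. K powr - \<alpha>) \<longlongrightarrow> 0) at_top"
      by (rule tendsto_neg_powr[OF _ filterlim_ident]) (use \<alpha> in simp)
    from eventually_conj[OF order_tendstoD(2)[OF this \<open>\<epsilon> > 0\<close>] eventually_gt_at_top[of 1]]
    obtain K :: real where K: "K powr - \<alpha> < \<epsilon>" "K > 1"
      by (auto dest!: eventually_happens)
    define \<G> where "\<G> = {U. open U \<and> (\<exists>z0 X. (\<forall>x\<ge>X. \<forall>z\<in>U \<inter> ?D. \<bar>h x z - g z0\<bar> \<le> \<epsilon>) \<and>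
      (\<forall>z\<in>U \<inter> ?D. \<bar>g z - g z0\<bar> \<le> \<epsilon>))}"
    have cover: "{1..K} \<times> S \<subseteq> \<Union>\<G>"
    proof
      fix z assume "z \<in> {1..K} \<times> S"
      then have "z \<in> ?D" by auto
      from local[OF this \<open>\<epsilon> > 0\<close>] show "z \<in> \<Union>\<G>"
        unfolding \<G>_def by blast
    qed
    \<comment> \<open>A Lebesgue number of the cover. Cells of extent below \<open>d / 2\<close> in
      each of the two coordinates lie in the \<open>d\<close>-ball around any of their points, hence
      in a single member of \<open>\<G>\<close>.\<close>
    obtain d where d: "0 < d" "\<And>z. z \<in> {1..K} \<times> S \<Longrightarrow> \<exists>U\<in>\<G>. ball z d \<subseteq> U"
      by (rule Heine_Borel_lemma[OF _ cover]) (auto simp: \<G>_def S intro!: compact_Times)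
    obtain \<P> where \<P>: "finite \<P>" "disjoint \<P>" "\<Union>\<P> = S" "\<And>T. T \<in> \<P> \<Longrightarrow> T \<in> sets borel"
      "\<And>T. T \<in> \<P> \<Longrightarrow> measure \<Upsilon> (subtopology euclidean S frontier_of T) = 0"
      "\<And>T x y. T \<in> \<P> \<Longrightarrow> x \<in> T \<Longrightarrow> y \<in> T \<Longrightarrow> dist x y < d / 2"
      using null_frontier_partition[OF \<Upsilon>(1,2) S, of "d / 2"] d by auto
    obtain m :: nat where m: "(K - 1) / m < d / 2" "m > 0"
    proof -
      obtain m :: nat where "(K - 1) / (d / 2) < m"
        using reals_Archimedean2 by blast
      moreover from this K d have "m > 0"
        by (intro gr0I) (auto simp: field_simps)
      ultimately show thesis
        using that[of m] d by (simp add: field_simps)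
    qed
    define a where "a i = 1 + real i * ((K - 1) / m)" for i
    have "a (Suc i) - a i = (K - 1) / m" for i
      unfolding a_def of_nat_Suc by (simp only: ring_distribs)
    then have a: "a 0 = 1" "a m = K" "a (Suc i) - a i < d / 2" for i
      using m by (auto simp: a_def)
    have a_mono: "mono a"
      using K m unfolding a_def by (intro monoI add_mono mult_right_mono) auto
    define A where "A = (\<lambda>(i, T). {a i<..a (Suc i)} \<times> (T :: 'a set))"
    define I where "I = {..<m} \<times> \<P>"
    have a_ge: "1 \<le> a i" for i
      using monoD[OF a_mono, of 0 i] a by simp
    have A_sub: "A j \<subseteq> {1..K} \<times> S" if jI: "j \<in> I" for j
    proof -
      obtain i T where j: "j = (i, T)" "i < m" "T \<in> \<P>" using jI by (auto simp: I_def)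
      then show ?thesis
        using \<P>(3) a_ge[of i] monoD[OF a_mono, of "Suc i" m] a(2) by (force simp: A_def)
    qed
    \<comment> \<open>The excluded radius 1 costs no mass: \<open>1 powr - \<alpha> = 1\<close>, so
      the cells miss exactly \<open>K powr - \<alpha>\<close> under \<open>\<nu>\<close>.\<close>
    have A_Union: "(\<Union>j\<in>I. A j) = {1<..K} \<times> S"
    proof -
      have "(\<Union>i<n. {a i<..a (Suc i)}) = {a 0<..a n}" for n
      proof (induction n)
        case (Suc n)
        have "{a 0<..a n} \<union> {a n<..a (Suc n)} = {a 0<..a (Suc n)}"
          using monoD[OF a_mono, of 0 n] monoD[OF a_mono, of n "Suc n"] by (intro ivl_disj_un) auto
        with Suc show ?case by (auto simp: lessThan_Suc)
      qed simp
      moreover have "(\<Union>j\<in>I. A j) = (\<Union>i<m. {a i<..a (Suc i)}) \<times> \<Union>\<P>"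
        by (auto simp: I_def A_def)
      ultimately show ?thesis using \<P>(3) a by simp
    qed
    have disj: "disjoint_family_on A I"
    proof -
      have "{a i<..a (Suc i)} \<inter> {a j<..a (Suc j)} = {}" if "i < j" for i j
        using monoD[OF a_mono, of "Suc i" j] that by auto
      then have 1: "{a i<..a (Suc i)} \<inter> {a j<..a (Suc j)} = {}" if "i \<noteq> j" for i j
        using that by (metis Int_commute linorder_neqE_nat)
      have 2: "T \<inter> T' = {}" if "T \<in> \<P>" "T' \<in> \<P>" "T \<noteq> T'" for T T'
        using \<P>(2) that by (auto dest: disjointD)
      show ?thesis
        unfolding disjoint_family_on_def
      proof (intro ballI impI)
        fix p q assume "p \<in> I" "q \<in> I" "p \<noteq> q"
        then obtain i T j T' where "p = (i, T)" "q = (j, T')" "T \<in> \<P>" "T' \<in> \<P>" "i \<noteq> j \<or> T \<noteq> T'"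
          by (auto simp: I_def)
        then show "A p \<inter> A q = {}"
          using 1[of i j] 2[of T T'] by (auto simp: A_def Times_Int_Times)
      qed
    qed
    have fin: "finite I" using \<P>(1) by (simp add: I_def)
    have A_sets: "A j \<in> sets \<nu>" if jI: "j \<in> I" for j
      using jI \<P>(4) by (auto simp: A_def I_def \<nu>(2) borel_prod[symmetric] intro!: pair_measureI)
    have "1 - (\<Sum>i\<in>I. measure \<nu> (A i)) = 1 - measure \<nu> ({1<..K} \<times> S)"
      using finite_measure.finite_measure_finite_Union[OF prob_space.finite_measure[OF \<nu>(1)] fin _ disj] A_sets
      unfolding A_Union[symmetric] by (simp add: image_subset_iff del: split_paired_All)
    also have "\<dots> = K powr - \<alpha>"
      using K compact_imp_closed[OF S] \<Upsilon>(3) by (subst \<nu>_rect) auto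
    finally have rest: "1 - (\<Sum>i\<in>I. measure \<nu> (A i)) \<le> \<epsilon>"
      using K by simp
    have lims: "((\<lambda>x. measure (\<mu> x) (A j)) \<longlongrightarrow> measure \<nu> (A j)) at_top" if jI: "j \<in> I" for j
    proof -
      obtain i T where j: "j = (i, T)" "i < m" "T \<in> \<P>" using jI by (auto simp: I_def)
      have "T \<subseteq> S" using j \<P>(3) by auto
      with \<mu>_rect[OF a_ge monoD[OF a_mono, of i "Suc i"] \<P>(4)[OF j(3)] _ \<P>(5)[OF j(3)]]
        \<nu>_rect[OF a_ge monoD[OF a_mono, of i "Suc i"] \<P>(4)[OF j(3)]]
      show ?thesis by (simp add: j A_def)
    qed
    \<comment> \<open>An empty cell admits any constant; otherwise any of its points determines a
      member of \<open>\<G>\<close> containing the cell, and that member supplies the constant and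
      the threshold.\<close>
    have "\<exists>c X. (\<forall>z\<in>A j. \<bar>g z - c\<bar> \<le> \<epsilon>) \<and> (\<forall>x\<ge>X. \<forall>z\<in>A j. \<bar>h x z - c\<bar> \<le> \<epsilon>)" if jI: "j \<in> I" for j
    proof (cases "A j = {}")
      case False
      then obtain z where z: "z \<in> A j" by blast
      obtain i T where j: "j = (i, T)" "i < m" "T \<in> \<P>" using jI by (auto simp: I_def)
      have "A j \<subseteq> ball z d"
      proof
        fix y assume y: "y \<in> A j"
        have "dist z y \<le> dist (fst z) (fst y) + dist (snd z) (snd y)"
          using dist_Pair_le[of "fst z" "snd z" "fst y" "snd y"] by simp
        also have "dist (fst z) (fst y) < d / 2"
        proof -
          have "a i < fst y" "fst y \<le> a (Suc i)" "a i < fst z" "fst z \<le> a (Suc i)"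
            using y z by (auto simp: A_def j)
          with a(3)[of i] show ?thesis
            unfolding dist_real_def by linarith
        qed
        also have "dist (snd z) (snd y) < d / 2"
          using y z \<P>(6)[OF j(3)] by (auto simp: A_def j)
        finally show "y \<in> ball z d" by simp
      qed
      with d(2)[of z] z A_sub[OF jI] obtain U where "U \<in> \<G>" "A j \<subseteq> U" by blast
      moreover have "A j \<subseteq> ?D" using A_sub[OF jI] by auto
      ultimately show ?thesis
        unfolding \<G>_def by blast
    qed auto
    then obtain c X where cX: "\<And>j z. j \<in> I \<Longrightarrow> z \<in> A j \<Longrightarrow> \<bar>g z - c j\<bar> \<le> \<epsilon>"
      "\<And>j x z. j \<in> I \<Longrightarrow> x \<ge> X j \<Longrightarrow> z \<in> A j \<Longrightarrow> \<bar>h x z - c j\<bar> \<le> \<epsilon>"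
      by metis
    then have "\<forall>j\<in>I. \<forall>\<^sub>F x in at_top. \<forall>z\<in>A j. \<bar>h x z - c j\<bar> \<le> \<epsilon>"
      unfolding eventually_at_top_linorder by blast
    with fin disj A_sets rest lims cX(1) show ?thesis by blast
  qed
  show ?thesis
  proof (rule tendsto_integral_step_approx[OF \<mu>(1) _ \<nu>(1) _ h(2) _ g(2) cells])
  qed (use \<mu>(2) \<nu>(2) h(1) g(1) in \<open>auto simp: measurable_cong_sets[OF \<nu>(2) refl]\<close>)
qed

section \<open>Product laws, conditioning and independent noise\<close>

lemma measurable_trunc_seq:
  fixes w :: "'z \<Rightarrow> nat \<Rightarrow> 'a::{second_countable_topology, zero}"
  assumes "\<And>j. (\<lambda>z. w z j) \<in> borel_measurable M"
  shows "(\<lambda>z. trunc_seq t (w z)) \<in> borel_measurable M"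
proof (rule measurable_coordinatewise_then_product)
  show "(\<lambda>z. trunc_seq t (w z) j) \<in> borel_measurable M" for j
    using assms[of j] by (cases "j \<le> t") (simp_all add: trunc_seq_def)
qed

lemma integral_pair_prob_space:
  fixes k :: "'a \<times> 'b \<Rightarrow> real"
  assumes A: "prob_space A" and B: "prob_space B"
    and k: "k \<in> borel_measurable (A \<Otimes>\<^sub>M B)" "\<And>z. \<bar>k z\<bar> \<le> C"
  shows "(\<integral>z. k z \<partial>(A \<Otimes>\<^sub>M B)) = (\<integral>x. \<integral>y. k (x, y) \<partial>B \<partial>A)"
proof -
  interpret A: prob_space A by fact
  interpret B: prob_space B by fact
  interpret pair_prob_space A B ..
  have "integrable (A \<Otimes>\<^sub>M B) k"
    by (rule integrable_const_bound[of _ C]) (use k in auto)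
  from integral_fst'[OF this] show ?thesis by simp
qed

text \<open>The second factor is a free measure \<open>Q\<close>, because under conditioning it will
  be the unconditional law of the noise. Agreement on rectangles determines the joint law.\<close>

lemma distr_Pair_eqI:
  assumes M: "prob_space M" and Q: "prob_space Q" "sets Q = sets Mb"
    and X [measurable]: "X \<in> M \<rightarrow>\<^sub>M Ma" and Y [measurable]: "Y \<in> M \<rightarrow>\<^sub>M Mb"
    and eq: "\<And>A B. A \<in> sets Ma \<Longrightarrow> B \<in> sets Mb \<Longrightarrow>
      measure M ((X -` A \<inter> space M) \<inter> (Y -` B \<inter> space M)) = measure M (X -` A \<inter> space M) * measure Q B"
  shows "distr M (Ma \<Otimes>\<^sub>M Mb) (\<lambda>\<omega>. (X \<omega>, Y \<omega>)) = distr M Ma X \<Otimes>\<^sub>M Q"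
proof (rule pair_measure_eqI[symmetric])
  interpret M: prob_space M by fact
  interpret Q: prob_space Q by fact
  interpret X: prob_space "distr M Ma X" by (rule M.prob_space_distr) fact
  show "sigma_finite_measure (distr M Ma X)" "sigma_finite_measure Q"
    by unfold_locales
  show "sets (distr M Ma X \<Otimes>\<^sub>M Q) = sets (distr M (Ma \<Otimes>\<^sub>M Mb) (\<lambda>\<omega>. (X \<omega>, Y \<omega>)))"
    using Q(2) by (auto intro: sets_pair_measure_cong)
  fix A B assume "A \<in> sets (distr M Ma X)" "B \<in> sets Q"
  then have [measurable]: "A \<in> sets Ma" "B \<in> sets Mb" using Q(2) by auto
  have "(\<lambda>\<omega>. (X \<omega>, Y \<omega>)) -` (A \<times> B) \<inter> space M = (X -` A \<inter> space M) \<inter> (Y -` B \<inter> space M)"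
    by auto
  then show "emeasure (distr M Ma X) A * emeasure Q B = emeasure (distr M (Ma \<Otimes>\<^sub>M Mb) (\<lambda>\<omega>. (X \<omega>, Y \<omega>))) (A \<times> B)"
    by (subst (1 2) emeasure_distr)
      (auto simp: M.emeasure_eq_measure Q.emeasure_eq_measure eq ennreal_mult)
qed

lemma indep_var_het_measure_Int:
  assumes M: "prob_space M" and indep: "indep_var_het M Ma X Mb Y" and "A \<in> sets Ma" "B \<in> sets Mb"
  shows "measure M ((X -` A \<inter> space M) \<inter> (Y -` B \<inter> space M))
    = measure M (X -` A \<inter> space M) * measure M (Y -` B \<inter> space M)"
  using assms(2-) unfolding indep_var_het_def
  by (intro prob_space.indep_setD[OF M]) (auto intro!: sigma_sets.Basic)

lemma distr_indep_var_het:
  assumes M: "prob_space M" and indep: "indep_var_het M Ma X Mb Y"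
  shows "distr M (Ma \<Otimes>\<^sub>M Mb) (\<lambda>\<omega>. (X \<omega>, Y \<omega>)) = distr M Ma X \<Otimes>\<^sub>M distr M Mb Y"
proof -
  have [measurable]: "X \<in> M \<rightarrow>\<^sub>M Ma" "Y \<in> M \<rightarrow>\<^sub>M Mb"
    using indep by (auto simp: indep_var_het_def)
  show ?thesis
    by (rule distr_Pair_eqI[OF M])
      (auto simp: measure_distr indep_var_het_measure_Int[OF M indep] intro!: prob_space.prob_space_distr[OF M])
qed

text \<open>The conditioning event speaks of \<open>X\<close> alone and merges with the event tested
  for \<open>X\<close>: \<open>X \<in> C\<close> and \<open>X \<in> A\<close> become
  \<open>X \<in> C \<inter> A\<close>. Independence then splits off \<open>Y\<close> with its
  original law.\<close>

lemma distr_uniform_indep_var_het: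
  assumes M: "prob_space M" and indep: "indep_var_het M Ma X Mb Y"
    and C: "C \<in> sets Ma" and B: "B = X -` C \<inter> space M" "measure M B \<noteq> 0"
  shows "distr (uniform_measure M B) (Ma \<Otimes>\<^sub>M Mb) (\<lambda>\<omega>. (X \<omega>, Y \<omega>))
    = distr (uniform_measure M B) Ma X \<Otimes>\<^sub>M distr M Mb Y"
proof -
  interpret prob_space M by fact
  have X: "X \<in> M \<rightarrow>\<^sub>M Ma" and Y: "Y \<in> M \<rightarrow>\<^sub>M Mb"
    using indep by (auto simp: indep_var_het_def)
  note [measurable] = X Y C
  have B0: "emeasure M B \<noteq> 0" "emeasure M B \<noteq> \<infinity>"
    using B(2) by (auto simp: emeasure_eq_measure)
  show ?thesis
  proof (rule distr_Pair_eqI)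
    show "prob_space (uniform_measure M B)"
      using B0 by (rule prob_space_uniform_measure)
    fix A A' assume A [measurable]: "A \<in> sets Ma" "A' \<in> sets Mb"
    have "B \<inter> ((X -` A \<inter> space M) \<inter> (Y -` A' \<inter> space M)) = (X -` (C \<inter> A) \<inter> space M) \<inter> (Y -` A' \<inter> space M)"
      "B \<inter> (X -` A \<inter> space M) = X -` (C \<inter> A) \<inter> space M"
      using B(1) by auto
    then show "measure (uniform_measure M B) ((X -` A \<inter> space (uniform_measure M B)) \<inter> (Y -` A' \<inter> space (uniform_measure M B)))
        = measure (uniform_measure M B) (X -` A \<inter> space (uniform_measure M B)) * measure (distr M Mb Y) A'"
      using indep_var_het_measure_Int[OF M indep, of "C \<inter> A" A'] B0
      by (simp add: measure_distr)
  qed (use X Y in \<open>auto intro!: prob_space_distr simp: measurable_def\<close>)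
qed

lemma distr_restrict_iid:
  assumes M: "prob_space M" and indep: "prob_space.indep_vars M (\<lambda>_. E) X {1..}"
    and ident: "\<And>i::nat. i \<ge> 1 \<Longrightarrow> distr M E (X i) = D"
  shows "distr M (PiM {1..} (\<lambda>_. E)) (\<lambda>\<omega>. restrict (\<lambda>i. X i \<omega>) {1..}) = PiM {1..} (\<lambda>_. D)"
proof -
  interpret prob_space M by fact
  have rv: "X i \<in> M \<rightarrow>\<^sub>M E" if "i \<in> {1..}" for i
    using indep that by (simp add: indep_vars_def2)
  have "distr M (PiM {1..} (\<lambda>_. E)) (\<lambda>\<omega>. \<lambda>i\<in>{1..}. X i \<omega>) = (\<Pi>\<^sub>M i\<in>{1..}. distr M E (X i))"
    using indep rv by (subst indep_vars_iff_distr_eq_PiM'[symmetric]) auto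
  also have "\<dots> = PiM {1..} (\<lambda>_. D)"
    by (rule PiM_cong) (auto simp: ident)
  finally show ?thesis .
qed

lemma indep_vars_PiM_coordinates:
  assumes D: "prob_space D" and "I \<noteq> {}"
  shows "prob_space.indep_vars (PiM I (\<lambda>_. D)) (\<lambda>_. D) (\<lambda>i v. v i) I"
proof -
  interpret P: prob_space "PiM I (\<lambda>_. D)"
    by (rule prob_space_PiM) (rule D)
  have "distr (PiM I (\<lambda>_. D)) (PiM I (\<lambda>_. D)) (\<lambda>v. \<lambda>i\<in>I. v i) = distr (PiM I (\<lambda>_. D)) (PiM I (\<lambda>_. D)) (\<lambda>v. v)"
    by (rule distr_cong) (auto simp: space_PiM)
  also have "\<dots> = PiM I (\<lambda>_. D)"
    by (rule distr_id)
  also have "\<dots> = (\<Pi>\<^sub>M i\<in>I. distr (PiM I (\<lambda>_. D)) D (\<lambda>v. v i))"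
    by (rule PiM_cong) (use distr_PiM_component[of I "\<lambda>_. D"] D in auto)
  finally show ?thesis
    using assms(2) by (subst P.indep_vars_iff_distr_eq_PiM') auto
qed

section \<open>Averages over the noise\<close>

text \<open>The state at time \<open>j\<close> depends on the coordinates \<open>1..j\<close> and is
  independent of coordinate \<open>Suc j\<close>. The exceptional null set in \<open>nz\<close>
  varies with \<open>y\<close> and cannot be removed for all states at once; a product argument over
  past and next noise handles it state by state.\<close>

lemma AE_orbit_nonzero:
  fixes \<Phi> :: "'a::euclidean_space \<Rightarrow> 'e \<Rightarrow> 'a"
  assumes D: "prob_space D" and \<Phi>: "(\<lambda>(y, e). \<Phi> y e) \<in> borel \<Otimes>\<^sub>M D \<rightarrow>\<^sub>M borel"
    and nz: "\<And>y. y \<noteq> 0 \<Longrightarrow> AE e in D. \<Phi> y e \<noteq> 0" and y: "y \<noteq> 0"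
  shows "AE v in PiM {1..} (\<lambda>_. D). orbit \<Phi> y v j \<noteq> 0"
proof (induction j)
  case 0
  show ?case using y by simp
next
  case (Suc j)
  let ?P = "PiM {1..} (\<lambda>_::nat. D)"
  let ?A = "PiM {1..j} (\<lambda>_. D)" and ?B = "PiM {Suc j} (\<lambda>_. D)"
  let ?X = "\<lambda>v::nat \<Rightarrow> 'e. restrict (\<lambda>i. v i) {1..j}" and ?Y = "\<lambda>v::nat \<Rightarrow> 'e. restrict (\<lambda>i. v i) {Suc j}"
  interpret P: prob_space ?P
    by (rule prob_space_PiM) (rule D)
  have "P.indep_var ?A ?X ?B ?Y"
    by (rule P.indep_var_restrict[OF indep_vars_PiM_coordinates[OF D]]) auto
  from this[unfolded P.indep_var_distribution_eq]
  have X [measurable]: "?X \<in> ?P \<rightarrow>\<^sub>M ?A" and Y [measurable]: "?Y \<in> ?P \<rightarrow>\<^sub>M ?B"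
    and joint: "distr ?P ?A ?X \<Otimes>\<^sub>M distr ?P ?B ?Y = distr ?P (?A \<Otimes>\<^sub>M ?B) (\<lambda>v. (?X v, ?Y v))"
    by blast+
  interpret X: prob_space "distr ?P ?A ?X" by (rule P.prob_space_distr) fact
  interpret Y: prob_space "distr ?P ?B ?Y" by (rule P.prob_space_distr) fact
  interpret XY: pair_prob_space "distr ?P ?A ?X" "distr ?P ?B ?Y" ..
  have "(\<lambda>w. (\<lambda>(y, v). orbit \<Phi> y v j) (y, w)) \<in> ?A \<rightarrow>\<^sub>M borel"
    by (rule measurable_compose[OF _ measurable_orbit[OF \<Phi> order_refl]]) simp
  then have orb [measurable]: "(\<lambda>w. orbit \<Phi> y w j) \<in> ?A \<rightarrow>\<^sub>M borel" by simp
  have \<Phi>_fix [measurable]: "\<Phi> m \<in> D \<rightarrow>\<^sub>M borel" for m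
    using measurable_compose[OF measurable_Pair1' \<Phi>, of m] by simp
  have [measurable]: "(\<lambda>w. w (Suc j)) \<in> ?B \<rightarrow>\<^sub>M D" by (rule measurable_component_singleton) simp
  have [measurable]: "(\<lambda>p. \<Phi> (orbit \<Phi> y (fst p) j) (snd p (Suc j))) \<in> ?A \<Otimes>\<^sub>M ?B \<rightarrow>\<^sub>M borel"
  proof -
    have "(\<lambda>p. (\<lambda>(y, e). \<Phi> y e) (orbit \<Phi> y (fst p) j, snd p (Suc j))) \<in> ?A \<Otimes>\<^sub>M ?B \<rightarrow>\<^sub>M borel"
      by (rule measurable_compose[OF _ \<Phi>]) measurable
    then show ?thesis by simp
  qed
  have set_meas: "{p \<in> space (?A \<Otimes>\<^sub>M ?B). \<Phi> (orbit \<Phi> y (fst p) j) (snd p (Suc j)) \<noteq> 0} \<in> sets (?A \<Otimes>\<^sub>M ?B)"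
    by measurable
  have 1: "AE w in distr ?P ?A ?X. orbit \<Phi> y w j \<noteq> 0"
  proof (subst AE_distr_iff)
    have "orbit \<Phi> y (?X v) j = orbit \<Phi> y v j" for v
      by (rule orbit_cong) auto
    then show "AE v in ?P. orbit \<Phi> y (?X v) j \<noteq> 0"
      using Suc.IH by simp
  qed (use orb in measurable)
  have 2: "AE w' in distr ?P ?B ?Y. \<Phi> m (w' (Suc j)) \<noteq> 0" if "m \<noteq> 0" for m
  proof (subst AE_distr_iff)
    have "AE v in ?P. \<Phi> m (v (Suc j)) \<noteq> 0"
      using AE_PiM_component[of "{1..}" "\<lambda>_. D" "Suc j"] D nz[OF that] by simp
    then show "AE v in ?P. \<Phi> m (?Y v (Suc j)) \<noteq> 0" by simp
  qed measurable
  have "AE p in distr ?P ?A ?X \<Otimes>\<^sub>M distr ?P ?B ?Y. \<Phi> (orbit \<Phi> y (fst p) j) (snd p (Suc j)) \<noteq> 0"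
  proof (rule XY.AE_pair_measure)
    show "{p \<in> space (distr ?P ?A ?X \<Otimes>\<^sub>M distr ?P ?B ?Y). \<Phi> (orbit \<Phi> y (fst p) j) (snd p (Suc j)) \<noteq> 0}
        \<in> sets (distr ?P ?A ?X \<Otimes>\<^sub>M distr ?P ?B ?Y)"
      unfolding joint sets_distr space_distr by (rule set_meas)
    show "AE w in distr ?P ?A ?X. AE w' in distr ?P ?B ?Y. \<Phi> (orbit \<Phi> y (fst (w, w')) j) (snd (w, w') (Suc j)) \<noteq> 0"
      using 1 by eventually_elim (use 2 in simp)
  qed
  then have "AE v in ?P. \<Phi> (orbit \<Phi> y (?X v) j) (?Y v (Suc j)) \<noteq> 0"
    unfolding joint by (subst (asm) AE_distr_iff[OF measurable_Pair[OF X Y] set_meas]) simp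
  moreover have "orbit \<Phi> y (?X v) j = orbit \<Phi> y v j" for v
    by (rule orbit_cong) auto
  ultimately show ?case by simp
qed

text \<open>\<open>z\<close> holds the radius in units of \<open>x\<close> and the direction, so
  trajectories start at radius \<open>fst z * x\<close> and are rescaled by it. Along any sequence
  of points tending to \<open>z\<close> pathwise convergence holds for almost every noise, and the
  bound \<open>C\<close> is an integrable majorant.\<close>

lemma tendsto_integral_orbit:
  fixes \<Phi> \<phi> :: "'a::euclidean_space \<Rightarrow> 'e \<Rightarrow> 'a" and f :: "real \<times> (nat \<Rightarrow> 'a) \<Rightarrow> real"
  assumes D: "prob_space D" and \<Phi>: "(\<lambda>(y, e). \<Phi> y e) \<in> borel \<Otimes>\<^sub>M D \<rightarrow>\<^sub>M borel"
    and \<phi>: "(\<lambda>(y, e). phi_ext \<phi> y e) \<in> borel \<Otimes>\<^sub>M D \<rightarrow>\<^sub>M borel"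
    and lim: "\<And>e s. e \<in> space D \<Longrightarrow> s \<in> sphere 0 1 \<Longrightarrow>
      ((\<lambda>(x, s). \<Phi> (x *\<^sub>R s) e /\<^sub>R x) \<longlongrightarrow> \<phi> s e) (at_top \<times>\<^sub>F inf (nhds s) (principal (sphere 0 1)))"
    and zero: "(AE e in D. linear_growth (\<lambda>y. \<Phi> y e)) \<or> (\<forall>s\<in>sphere 0 1. AE e in D. \<phi> s e \<noteq> 0)"
    and f: "continuous_on UNIV f" "\<And>z. \<bar>f z\<bar> \<le> C"
    and z: "z \<in> {1..} \<times> sphere 0 1"
  shows "((\<lambda>(x, z). \<integral>v. f (fst z, trunc_seq t (\<lambda>j. orbit \<Phi> ((fst z * x) *\<^sub>R snd z) v j /\<^sub>R (fst z * x))) \<partial>PiM {1..} (\<lambda>_. D))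
      \<longlongrightarrow> (\<integral>v. f (fst z, trunc_seq t (\<lambda>j. orbit (phi_ext \<phi>) (snd z) v j)) \<partial>PiM {1..} (\<lambda>_. D)))
      (at_top \<times>\<^sub>F inf (nhds z) (principal ({1..} \<times> sphere 0 1)))"
proof (rule tendsto_prod_at_top_sequentiallyI)
  let ?P = "PiM {1..} (\<lambda>_::nat. D)"
  interpret P: prob_space ?P
    by (rule prob_space_PiM) (rule D)
  have f_meas: "f \<in> borel_measurable (borel \<Otimes>\<^sub>M borel)"
    using borel_measurable_continuous_onI[OF f(1)] by (simp add: borel_prod)
  have orbit_meas: "(\<lambda>v. orbit \<Psi> y v j) \<in> ?P \<rightarrow>\<^sub>M borel"
    if "(\<lambda>(y, e). \<Psi> y e) \<in> borel \<Otimes>\<^sub>M D \<rightarrow>\<^sub>M borel" for \<Psi> :: "'a \<Rightarrow> 'e \<Rightarrow> 'a" and y j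
    using measurable_compose[OF measurable_Pair1' measurable_orbit[OF that, of j "{1..}"], of y] by auto
  obtain u0 s0 where z0: "z = (u0, s0)" "u0 \<ge> 1" "s0 \<in> sphere 0 1" using z by auto
  fix x :: "nat \<Rightarrow> real" and p :: "nat \<Rightarrow> real \<times> 'a"
  assume x: "filterlim x at_top sequentially" and p: "\<And>n. p n \<in> {1..} \<times> sphere 0 1" "p \<longlonglongrightarrow> z"
  have u: "(\<lambda>n. fst (p n)) \<longlonglongrightarrow> u0" and s: "(\<lambda>n. snd (p n)) \<longlonglongrightarrow> s0"
    using tendsto_fst[OF p(2)] tendsto_snd[OF p(2)] by (simp_all add: z0)
  have r: "filterlim (\<lambda>n. fst (p n) * x n) at_top sequentially"
    using z0 by (intro filterlim_tendsto_pos_mult_at_top[OF u _ x]) simp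
  \<comment> \<open>Under the first alternative growth holds at all of the countably many times.
    Under the second the limit trajectory, started on the sphere, almost surely never vanishes, so
    the premise is never met.\<close>
  have growth: "AE v in ?P. \<forall>i. orbit (phi_ext \<phi>) s0 v i = 0 \<longrightarrow> linear_growth (\<lambda>y. \<Phi> y (v (Suc i)))"
    using zero
  proof
    assume "AE e in D. linear_growth (\<lambda>y. \<Phi> y e)"
    then have "AE v in ?P. linear_growth (\<lambda>y. \<Phi> y (v (Suc i)))" for i
      using AE_PiM_component[of "{1..}" "\<lambda>_. D" "Suc i"] D by simp
    then have "AE v in ?P. \<forall>i. linear_growth (\<lambda>y. \<Phi> y (v (Suc i)))"
      by (simp add: AE_all_countable)
    then show ?thesis by eventually_elim auto
  next
    assume nz: "\<forall>s\<in>sphere 0 1. AE e in D. \<phi> s e \<noteq> 0"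
    have "AE e in D. phi_ext \<phi> y e \<noteq> 0" if "y \<noteq> 0" for y
    proof -
      have "AE e in D. \<phi> (y /\<^sub>R norm y) e \<noteq> 0" using nz that by simp
      then show ?thesis by eventually_elim (use that in \<open>auto simp: phi_ext_def\<close>)
    qed
    then have "AE v in ?P. orbit (phi_ext \<phi>) s0 v i \<noteq> 0" for i
      using z0 by (intro AE_orbit_nonzero[OF D \<phi>]) auto
    then have "AE v in ?P. \<forall>i. orbit (phi_ext \<phi>) s0 v i \<noteq> 0"
      by (simp add: AE_all_countable)
    then show ?thesis by eventually_elim auto
  qed
  show "(\<lambda>n. \<integral>v. f (fst (p n), trunc_seq t (\<lambda>j. orbit \<Phi> ((fst (p n) * x n) *\<^sub>R snd (p n)) v j /\<^sub>R (fst (p n) * x n))) \<partial>?P)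
    \<longlonglongrightarrow> (\<integral>v. f (fst z, trunc_seq t (\<lambda>j. orbit (phi_ext \<phi>) (snd z) v j)) \<partial>?P)"
  proof (rule integral_dominated_convergence[where w="\<lambda>_. C"])
    show "(\<lambda>v. f (fst z, trunc_seq t (\<lambda>j. orbit (phi_ext \<phi>) (snd z) v j))) \<in> borel_measurable ?P"
      by (intro measurable_compose[OF _ f_meas] measurable_Pair measurable_trunc_seq orbit_meas \<phi>) simp
    show "(\<lambda>v. f (fst (p n), trunc_seq t (\<lambda>j. orbit \<Phi> ((fst (p n) * x n) *\<^sub>R snd (p n)) v j /\<^sub>R (fst (p n) * x n)))) \<in> borel_measurable ?P" for n
      by (intro measurable_compose[OF _ f_meas] measurable_Pair measurable_trunc_seq
        borel_measurable_scaleR borel_measurable_const orbit_meas \<Phi>)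
    show "AE v in ?P. (\<lambda>n. f (fst (p n), trunc_seq t (\<lambda>j. orbit \<Phi> ((fst (p n) * x n) *\<^sub>R snd (p n)) v j /\<^sub>R (fst (p n) * x n))))
        \<longlonglongrightarrow> f (fst z, trunc_seq t (\<lambda>j. orbit (phi_ext \<phi>) (snd z) v j))"
      using growth AE_space
    proof eventually_elim
      case (elim v)
      have orb: "(\<lambda>n. orbit \<Phi> ((fst (p n) * x n) *\<^sub>R snd (p n)) v j /\<^sub>R (fst (p n) * x n))
          \<longlonglongrightarrow> orbit (phi_ext \<phi>) s0 v j" for j
      proof (rule tendsto_orbit[OF lim _ r s])
        show "v i \<in> space D" if "i \<ge> 1" for i
          using elim(2) that by (auto simp: space_PiM)
      qed (use elim(1) in auto)
      have "(\<lambda>n. trunc_seq t (\<lambda>j. orbit \<Phi> ((fst (p n) * x n) *\<^sub>R snd (p n)) v j /\<^sub>R (fst (p n) * x n)))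
          \<longlonglongrightarrow> trunc_seq t (\<lambda>j. orbit (phi_ext \<phi>) s0 v j)"
      proof (rule tendsto_product_coordinatewise)
        show "(\<lambda>n. trunc_seq t (\<lambda>j. orbit \<Phi> ((fst (p n) * x n) *\<^sub>R snd (p n)) v j /\<^sub>R (fst (p n) * x n)) i)
            \<longlonglongrightarrow> trunc_seq t (\<lambda>j. orbit (phi_ext \<phi>) s0 v j) i" for i
          using orb[of i] by (cases "i \<le> t") (simp_all add: trunc_seq_def)
      qed
      from tendsto_Pair[OF u this]
      show ?case
        using f(1) by (auto simp: z0 continuous_on_eq_continuous_at intro: isCont_tendsto_compose)
    qed
    show "integrable ?P (\<lambda>_. C)"
      by (rule P.integrable_const)
  qed (use f(2) in auto)
qed

section \<open>Weak convergence to the forward tail chain\<close>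

theorem theorem2p4:
  fixes M :: "'w measure" and E :: "'e measure"
    and Phi :: "'a::euclidean_space \<Rightarrow> 'e \<Rightarrow> 'a"
    and X0 :: "'w \<Rightarrow> 'a" and eps :: "nat \<Rightarrow> 'w \<Rightarrow> 'e"
    and \<alpha> :: real and \<Upsilon> :: "'a measure"
    and phi :: "'a \<Rightarrow> 'e \<Rightarrow> 'a"
  assumes M: "prob_space M"
    and Phi_meas: "(\<lambda>(y, e). Phi y e) \<in> borel \<Otimes>\<^sub>M E \<rightarrow>\<^sub>M borel"
    and X0_meas: "X0 \<in> borel_measurable M"
    and eps_meas: "\<And>i. i \<ge> 1 \<Longrightarrow> eps i \<in> M \<rightarrow>\<^sub>M E"
    and eps_indep: "prob_space.indep_vars M (\<lambda>_. E) eps {1..}"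
    and eps_ident: "\<And>i. i \<ge> 1 \<Longrightarrow> distr M E (eps i) = distr M E (eps 1)"
    and X0_indep: "indep_var_het M borel X0 (PiM {1..} (\<lambda>_. E))
                     (\<lambda>\<omega>. restrict (\<lambda>i. eps i \<omega>) {1..})"
    and alpha_pos: "\<alpha> > 0"
    and Ups_prob: "prob_space \<Upsilon>"
    and Ups_sets: "sets \<Upsilon> = sets borel"
    and Ups_sphere: "measure \<Upsilon> (sphere 0 1) = 1"
    and RV: "\<And>u S. u \<ge> 1 \<Longrightarrow> S \<in> sets borel \<Longrightarrow> S \<subseteq> sphere 0 1 \<Longrightarrow>
               measure \<Upsilon> (subtopology euclidean (sphere 0 1) frontier_of S) = 0 \<Longrightarrow>
               ((\<lambda>x. measure M {\<omega> \<in> space M. norm (X0 \<omega>) > u * x \<and> X0 \<omega> /\<^sub>R norm (X0 \<omega>) \<in> S}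
                     / measure M {\<omega> \<in> space M. norm (X0 \<omega>) > x})
                 \<longlongrightarrow> u powr (- \<alpha>) * measure \<Upsilon> S) at_top"
    and phi_meas: "(\<lambda>(s, e). phi s e) \<in> restrict_space borel (sphere 0 1) \<Otimes>\<^sub>M E \<rightarrow>\<^sub>M borel"
    and phi_lim: "\<And>e s s0. e \<in> space E \<Longrightarrow> (\<forall>x. s x \<in> sphere 0 1) \<Longrightarrow> s0 \<in> sphere 0 1 \<Longrightarrow>
               (s \<longlongrightarrow> s0) at_top \<Longrightarrow>
               ((\<lambda>x. Phi (x *\<^sub>R s x) e /\<^sub>R x) \<longlongrightarrow> phi s0 e) at_top"
    and phi_zero: "(\<exists>s \<in> sphere 0 1. measure M {\<omega> \<in> space M. phi s (eps 1 \<omega>) = 0} > 0) \<Longrightarrow>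
               (\<exists>W \<in> sets E. measure M {\<omega> \<in> space M. eps 1 \<omega> \<in> W} = 1 \<and>
                  (\<forall>e \<in> W. \<exists>C. \<forall>\<^sub>F x in at_top. \<forall>y. norm y \<le> x \<longrightarrow> norm (Phi y e) \<le> C * x))"
  shows "\<forall>(N :: 'v measure) (Y :: 'v \<Rightarrow> real) (M0 :: 'v \<Rightarrow> 'a) (e :: nat \<Rightarrow> 'v \<Rightarrow> 'e).
           prob_space N \<and>
           indep_var_het N borel Y (borel \<Otimes>\<^sub>M PiM {1..} (\<lambda>_. E))
             (\<lambda>\<omega>. (M0 \<omega>, restrict (\<lambda>i. e i \<omega>) {1..})) \<and>
           indep_var_het N borel M0 (PiM {1..} (\<lambda>_. E)) (\<lambda>\<omega>. restrict (\<lambda>i. e i \<omega>) {1..}) \<and>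
           prob_space.indep_vars N (\<lambda>_. E) e {1..} \<and>
           (\<forall>i\<ge>1. distr N E (e i) = distr M E (eps 1)) \<and>
           (\<forall>y\<ge>1. measure N {\<omega> \<in> space N. Y \<omega> > y} = y powr (- \<alpha>)) \<and>
           distr N borel M0 = \<Upsilon>
           \<longrightarrow> (\<forall>t::nat.
                 weak_conv_at
                   (\<lambda>x. cond_law M borel
                      (\<lambda>\<omega>. (norm (X0 \<omega>) / x,
                              trunc_seq t (\<lambda>j. Xseq Phi X0 eps j \<omega> /\<^sub>R norm (X0 \<omega>))))
                      {\<omega> \<in> space M. norm (X0 \<omega>) > x})
                   (distr N borel (\<lambda>\<omega>. (Y \<omega>, trunc_seq t (\<lambda>j. Xseq (phi_ext phi) M0 e j \<omega>))))
                   at_top)"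
proof (intro allI impI, elim conjE)
  fix N :: "'v measure" and Y :: "'v \<Rightarrow> real" and M0 :: "'v \<Rightarrow> 'a" and e :: "nat \<Rightarrow> 'v \<Rightarrow> 'e" and t :: nat
  let ?S = "sphere (0::'a) 1"
  let ?PE = "PiM {1..} (\<lambda>_::nat. E)"
  let ?VM = "\<lambda>\<omega>. restrict (\<lambda>i. eps i \<omega>) {1..}" and ?VN = "\<lambda>\<omega>. restrict (\<lambda>i. e i \<omega>) {1..}"
  assume N: "prob_space N"
    and Y_indep: "indep_var_het N borel Y (borel \<Otimes>\<^sub>M ?PE) (\<lambda>\<omega>. (M0 \<omega>, ?VN \<omega>))"
    and M0_indep: "indep_var_het N borel M0 ?PE ?VN"
    and e_indep: "prob_space.indep_vars N (\<lambda>_. E) e {1..}"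
    and e_ident: "\<forall>i\<ge>1. distr N E (e i) = distr M E (eps 1)"
    and Y_law: "\<forall>y\<ge>1. measure N {\<omega> \<in> space N. Y \<omega> > y} = y powr (- \<alpha>)"
    and M0_law: "distr N borel M0 = \<Upsilon>"
  interpret M: prob_space M by fact
  interpret N: prob_space N by fact
  interpret U: prob_space \<Upsilon> by fact
  define D where "D = distr M E (eps 1)"
  define P where "P = PiM {1..} (\<lambda>_::nat. D)"
  note [measurable] = X0_meas
  have sets_D [measurable_cong]: "sets D = sets E" by (simp add: D_def)
  have space_D: "space D = space E" by (simp add: D_def)
  have D: "prob_space D"
    unfolding D_def by (rule M.prob_space_distr) (rule eps_meas, simp)
  interpret P: prob_space P
    unfolding P_def by (rule prob_space_PiM) (rule D)
  have sets_P [measurable_cong]: "sets P = sets ?PE"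
    unfolding P_def by (rule sets_PiM_cong) (simp_all add: sets_D)
  have \<Phi>D: "(\<lambda>(y, e). Phi y e) \<in> borel \<Otimes>\<^sub>M D \<rightarrow>\<^sub>M borel"
    and \<phi>D: "(\<lambda>(y, e). phi_ext phi y e) \<in> borel \<Otimes>\<^sub>M D \<rightarrow>\<^sub>M borel"
    using Phi_meas measurable_phi_ext[OF phi_meas]
    by (simp_all add: measurable_cong_sets[OF sets_pair_measure_cong[OF refl sets_D] refl])
  have VM: "?VM \<in> M \<rightarrow>\<^sub>M ?PE" and VN [measurable]: "?VN \<in> N \<rightarrow>\<^sub>M ?PE"
    and Y_meas [measurable]: "Y \<in> borel_measurable N" and M0_meas [measurable]: "M0 \<in> borel_measurable N"
    using X0_indep M0_indep Y_indep by (auto simp: indep_var_het_def)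
  have VM_law: "distr M ?PE ?VM = P"
    unfolding P_def D_def by (rule distr_restrict_iid[OF M eps_indep eps_ident])
  have VN_law: "distr N ?PE ?VN = P"
    unfolding P_def by (rule distr_restrict_iid[OF N e_indep]) (use e_ident in \<open>simp add: D_def\<close>)
  have lim: "((\<lambda>(x, s). Phi (x *\<^sub>R s) e /\<^sub>R x) \<longlongrightarrow> phi s e) (at_top \<times>\<^sub>F inf (nhds s) (principal ?S))"
    if "e \<in> space D" "s \<in> ?S" for e s
    using that by (intro tendsto_prod_at_topI phi_lim) (auto simp: space_D)
  \<comment> \<open>If the premise of \<open>phi_zero\<close> fails, each direction is sent to 0
    with probability 0; the exceptional noise set may depend on the direction, as the second
    alternative allows.\<close>
  have zero: "(AE e in D. linear_growth (\<lambda>y. Phi y e)) \<or> (\<forall>s\<in>?S. AE e in D. phi s e \<noteq> 0)"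
  proof (cases "\<exists>s\<in>?S. measure M {\<omega> \<in> space M. phi s (eps 1 \<omega>) = 0} > 0")
    case True
    from phi_zero[OF this] obtain W where W: "W \<in> sets E" "measure M {\<omega> \<in> space M. eps 1 \<omega> \<in> W} = 1"
      "\<And>e. e \<in> W \<Longrightarrow> linear_growth (\<lambda>y. Phi y e)"
      unfolding linear_growth_def by blast
    have "eps 1 -` W \<inter> space M = {\<omega> \<in> space M. eps 1 \<omega> \<in> W}" by auto
    with W(1,2) have "measure D W = 1"
      unfolding D_def by (subst measure_distr) (auto intro: eps_meas)
    then have "AE e in D. e \<in> W"
      using prob_space.AE_in_set_eq_1[OF D, of W] W(1) sets_D by simp
    then have "AE e in D. linear_growth (\<lambda>y. Phi y e)"
      by eventually_elim (rule W)
    then show ?thesis ..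
  next
    case False
    have "AE e in D. phi s e \<noteq> 0" if s: "s \<in> ?S" for s
    proof -
      have "(\<lambda>e. (\<lambda>(s, e). phi s e) (s, e)) \<in> E \<rightarrow>\<^sub>M borel"
        by (rule measurable_compose[OF measurable_Pair1' phi_meas]) (use s in \<open>simp add: space_restrict_space\<close>)
      then have [measurable]: "phi s \<in> E \<rightarrow>\<^sub>M borel" by simp
      have [measurable]: "eps 1 \<in> M \<rightarrow>\<^sub>M E" by (rule eps_meas) simp
      have zero_set: "{\<omega> \<in> space M. phi s (eps 1 \<omega>) = 0} \<in> sets M"
        by measurable
      have "measure M {\<omega> \<in> space M. phi s (eps 1 \<omega>) = 0} = 0"
        using False s by (meson measure_nonneg not_less order_antisym)
      then have "AE \<omega> in M. \<omega> \<notin> {\<omega> \<in> space M. phi s (eps 1 \<omega>) = 0}"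
        by (intro AE_not_in) (use zero_set in \<open>auto simp: null_sets_def M.emeasure_eq_measure\<close>)
      then have "AE \<omega> in M. phi s (eps 1 \<omega>) \<noteq> 0"
        using AE_space by eventually_elim auto
      then show ?thesis
        unfolding D_def by (subst AE_distr_iff) measurable
    qed
    then show ?thesis by blast
  qed

  define B where "B x = {\<omega> \<in> space M. norm (X0 \<omega>) > x}" for x
  have B_vimage: "B x = X0 -` {y. norm y > x} \<inter> space M" for x
    by (auto simp: B_def)
  have B_sets [measurable]: "B x \<in> sets M" for x
    unfolding B_def by measurable
  have Ups_S: "measure \<Upsilon> ?S = 1" by (rule Ups_sphere)
  \<comment> \<open>Division by 0 yields 0, yet regular variation with \<open>u = 1\<close> and the
    whole sphere, whose relative frontier is empty, makes the quotient tend to 1. So the denominator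
    is eventually nonzero.\<close>
  have "\<forall>\<^sub>F x in at_top. measure M (B x) \<noteq> 0"
  proof -
    have "((\<lambda>x. measure M {\<omega> \<in> space M. norm (X0 \<omega>) > 1 * x \<and> X0 \<omega> /\<^sub>R norm (X0 \<omega>) \<in> ?S} / measure M (B x))
        \<longlongrightarrow> 1 powr - \<alpha> * measure \<Upsilon> ?S) at_top"
      unfolding B_def using frontier_of_topspace[of "top_of_set ?S"] by (intro RV) auto
    from tendsto_imp_eventually_ne[OF this, of 0] Ups_S show ?thesis
      by (auto elim: eventually_mono)
  qed
  with eventually_gt_at_top[of 0] have good: "\<forall>\<^sub>F x in at_top. x > 0 \<and> measure M (B x) \<noteq> 0"
    by eventually_elim auto
  define Q where "Q x = uniform_measure M (B x)" for x
  have Q_prob: "prob_space (Q x)" if "measure M (B x) \<noteq> 0" for x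
    unfolding Q_def using that by (intro prob_space_uniform_measure) (auto simp: M.emeasure_eq_measure)
  have sets_Q [measurable_cong]: "sets (Q x) = sets M" and space_Q: "space (Q x) = space M" for x
    by (simp_all add: Q_def)
  have measure_Q: "measure (Q x) A = measure M (B x \<inter> A) / measure M (B x)"
    if "measure M (B x) \<noteq> 0" "A \<in> sets M" for x A
    unfolding Q_def using that by (intro measure_uniform_measure) (auto simp: M.emeasure_eq_measure)
  define polar where "polar x \<omega> = (norm (X0 \<omega>) / x, X0 \<omega> /\<^sub>R norm (X0 \<omega>))" for x \<omega>
  have polar [measurable]: "polar x \<in> borel_measurable M" for x
    unfolding polar_def by (simp add: borel_prod[symmetric])
  define \<mu> where "\<mu> x = distr (Q x) borel (polar x)" for x
  have sets_\<mu>: "sets (\<mu> x) = sets borel" for x by (simp add: \<mu>_def)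
  have \<mu>_prob: "\<forall>\<^sub>F x in at_top. prob_space (\<mu> x)"
    using good unfolding \<mu>_def
    by eventually_elim (intro prob_space.prob_space_distr Q_prob, auto)
  have \<mu>_rect: "((\<lambda>x. measure (\<mu> x) ({a<..b} \<times> T)) \<longlongrightarrow> (a powr - \<alpha> - b powr - \<alpha>) * measure \<Upsilon> T) at_top"
    if ab: "1 \<le> a" "a \<le> b" and T [measurable]: "T \<in> sets borel" and T': "T \<subseteq> ?S"
      "measure \<Upsilon> (subtopology euclidean ?S frontier_of T) = 0" for a b T
  proof -
    \<comment> \<open>The event in the assumption of regular variation. For \<open>x > 0\<close> the
      preimage of \<open>{a<..b} \<times> T\<close> within \<open>B x\<close> is
      \<open>R a x - R b x\<close>, where \<open>a \<ge> 1\<close> ensures that \<open>R a x\<close>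
      lies in \<open>B x\<close>.\<close>
    define R where "R u x = {\<omega> \<in> space M. norm (X0 \<omega>) > u * x \<and> X0 \<omega> /\<^sub>R norm (X0 \<omega>) \<in> T}" for u x
    have rect: "{a<..b} \<times> T \<in> sets borel"
      unfolding borel_prod[symmetric] by measurable
    have R_sets [measurable]: "R u x \<in> sets M" for u x unfolding R_def by measurable
    have R_lim: "((\<lambda>x. measure M (R u x) / measure M (B x)) \<longlongrightarrow> u powr - \<alpha> * measure \<Upsilon> T) at_top" if "u \<ge> 1" for u
      unfolding R_def B_def using that T T' by (rule RV)
    have "((\<lambda>x. measure M (R a x) / measure M (B x) - measure M (R b x) / measure M (B x))
        \<longlongrightarrow> a powr - \<alpha> * measure \<Upsilon> T - b powr - \<alpha> * measure \<Upsilon> T) at_top"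
      using ab by (intro tendsto_diff R_lim) auto
    moreover have "\<forall>\<^sub>F x in at_top. measure M (R a x) / measure M (B x) - measure M (R b x) / measure M (B x)
        = measure (\<mu> x) ({a<..b} \<times> T)"
      using good
    proof eventually_elim
      case (elim x)
      have "measure (\<mu> x) ({a<..b} \<times> T) = measure (Q x) (polar x -` ({a<..b} \<times> T) \<inter> space M)"
        unfolding \<mu>_def by (subst measure_distr) (use rect in \<open>auto simp: space_Q\<close>)
      also have "\<dots> = measure M (B x \<inter> (polar x -` ({a<..b} \<times> T) \<inter> space M)) / measure M (B x)"
      proof (rule measure_Q)
        show "polar x -` ({a<..b} \<times> T) \<inter> space M \<in> sets M"
          using polar rect by (rule measurable_sets)
      qed (use elim in simp)
      also have "B x \<inter> (polar x -` ({a<..b} \<times> T) \<inter> space M) = R a x - R b x"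
      proof -
        have "x \<le> a * x" using ab elim by simp
        then have "x < y" if "a * x < y" for y using that by linarith
        then show ?thesis
          using elim by (auto simp: B_def R_def polar_def pos_less_divide_eq pos_divide_le_eq)
      qed
      also have "measure M (R a x - R b x) = measure M (R a x) - measure M (R b x)"
      proof (rule M.finite_measure_Diff)
        have "a * x \<le> b * x" using ab elim by (intro mult_right_mono) auto
        then show "R b x \<subseteq> R a x" by (auto simp: R_def)
      qed auto
      finally show ?case by (simp add: diff_divide_distrib)
    qed
    ultimately show ?thesis
      by (simp add: tendsto_cong left_diff_distrib)
  qed

  interpret Y: prob_space "distr N borel Y"
    by (rule N.prob_space_distr) fact
  define \<nu> where "\<nu> = distr N borel Y \<Otimes>\<^sub>M \<Upsilon>"
  interpret YU: pair_prob_space "distr N borel Y" \<Upsilon> ..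
  have \<nu>_prob: "prob_space \<nu>" unfolding \<nu>_def by (rule YU.prob_space_axioms)
  have sets_\<nu>: "sets \<nu> = sets borel"
    unfolding \<nu>_def borel_prod[symmetric] by (rule sets_pair_measure_cong) (simp_all add: Ups_sets)
  have \<nu>_rect: "measure \<nu> ({a<..b} \<times> T) = (a powr - \<alpha> - b powr - \<alpha>) * measure \<Upsilon> T"
    if ab: "1 \<le> a" "a \<le> b" and T: "T \<in> sets borel" for a b T
  proof -
    have "emeasure \<nu> ({a<..b} \<times> T) = emeasure (distr N borel Y) {a<..b} * emeasure \<Upsilon> T"
      unfolding \<nu>_def using T Ups_sets by (intro U.emeasure_pair_measure_Times) auto
    then have "measure \<nu> ({a<..b} \<times> T) = measure (distr N borel Y) {a<..b} * measure \<Upsilon> T"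
      by (simp add: measure_def enn2real_mult)
    also have "measure (distr N borel Y) {a<..b} = measure N ({\<omega> \<in> space N. Y \<omega> > a} - {\<omega> \<in> space N. Y \<omega> > b})"
      by (subst measure_distr) (auto intro!: arg_cong[where f="measure N"])
    also have "\<dots> = a powr - \<alpha> - b powr - \<alpha>"
      using ab Y_law by (subst N.finite_measure_Diff) auto
    finally show ?thesis .
  qed

  show "weak_conv_at
      (\<lambda>x. cond_law M borel
        (\<lambda>\<omega>. (norm (X0 \<omega>) / x, trunc_seq t (\<lambda>j. Xseq Phi X0 eps j \<omega> /\<^sub>R norm (X0 \<omega>))))
        {\<omega> \<in> space M. norm (X0 \<omega>) > x})
      (distr N borel (\<lambda>\<omega>. (Y \<omega>, trunc_seq t (\<lambda>j. Xseq (phi_ext phi) M0 e j \<omega>)))) at_top"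
    unfolding weak_conv_at_def
  proof (intro allI impI)
    fix f :: "real \<times> (nat \<Rightarrow> 'a) \<Rightarrow> real"
    assume f: "continuous_on UNIV f" "bounded (range f)"
    then obtain C where C: "\<And>z. \<bar>f z\<bar> \<le> C"
      by (auto simp: bounded_iff)
    have f_borel: "f \<in> borel_measurable borel"
      by (rule borel_measurable_continuous_onI[OF f(1)])
    then have f_meas: "f \<in> borel_measurable (borel \<Otimes>\<^sub>M borel)"
      by (simp add: borel_prod)
    have orbit_meas: "(\<lambda>p. orbit \<Psi> (a p) (w p) j) \<in> borel_measurable K"
      if "(\<lambda>(y, e). \<Psi> y e) \<in> borel \<Otimes>\<^sub>M D \<rightarrow>\<^sub>M borel" "a \<in> borel_measurable K" "w \<in> K \<rightarrow>\<^sub>M P"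
      for \<Psi> :: "'a \<Rightarrow> 'e \<Rightarrow> 'a" and a w j and K :: "'k measure"
      using measurable_compose[OF measurable_Pair[OF that(2,3)[unfolded P_def]] measurable_orbit[OF that(1), of j "{1..}"]]
      by auto
    \<comment> \<open>At \<open>z = polar x \<omega>\<close> with \<open>x \<noteq> 0\<close> the
      factor \<open>fst z * x\<close> equals \<open>norm (X0 \<omega>)\<close>, so \<open>h\<close>
      is the mean over fresh noise with the start held at \<open>X0 \<omega>\<close>.\<close>
    define h where "h x z = (\<integral>v. f (fst z, trunc_seq t (\<lambda>j. orbit Phi ((fst z * x) *\<^sub>R snd z) v j /\<^sub>R (fst z * x))) \<partial>P)"
      for x :: real and z :: "real \<times> 'a"
    define g where "g z = (\<integral>v. f (fst z, trunc_seq t (\<lambda>j. orbit (phi_ext phi) (snd z) v j)) \<partial>P)"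
      for z :: "real \<times> 'a"
    \<comment> \<open>True for every \<open>k\<close>, measurable or not: a non-integrable integrand
      has integral 0, and \<open>C \<ge> 0\<close>.\<close>
    have integral_bound: "\<bar>\<integral>v. f (k v) \<partial>P\<bar> \<le> C" for k
    proof -
      have "C \<ge> 0" using C by (meson abs_ge_zero order_trans)
      show ?thesis
      proof (cases "integrable P (\<lambda>v. f (k v))")
        case True
        have "\<bar>\<integral>v. f (k v) \<partial>P\<bar> \<le> (\<integral>v. \<bar>f (k v)\<bar> \<partial>P)" by (rule integral_abs_bound)
        also have "\<dots> \<le> (\<integral>v. C \<partial>P)" using True C by (intro integral_mono) auto
        finally show ?thesis by (simp add: P.prob_space)
      qed (use \<open>C \<ge> 0\<close> in \<open>simp add: not_integrable_integral_eq\<close>)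
    qed
    have h_meas: "h x \<in> borel_measurable borel" for x
      unfolding h_def borel_prod[symmetric]
      by (rule P.borel_measurable_lebesgue_integral, unfold case_prod_unfold,
          intro measurable_compose[OF _ f_meas] measurable_Pair measurable_trunc_seq
            borel_measurable_scaleR orbit_meas \<Phi>D) measurable
    have g_meas: "g \<in> borel_measurable borel"
      unfolding g_def borel_prod[symmetric]
      by (rule P.borel_measurable_lebesgue_integral, unfold case_prod_unfold,
          intro measurable_compose[OF _ f_meas] measurable_Pair measurable_trunc_seq
            orbit_meas \<phi>D) measurable
    have h_C: "\<bar>h x z\<bar> \<le> C" and g_C: "\<bar>g z\<bar> \<le> C" for x z
      unfolding h_def g_def by (rule integral_bound)+
    have hg: "((\<lambda>x. \<integral>z. h x z \<partial>\<mu> x) \<longlongrightarrow> (\<integral>z. g z \<partial>\<nu>)) at_top"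
    proof (rule tendsto_integral_regular_variation[OF \<mu>_prob sets_\<mu> \<nu>_prob sets_\<nu> _ Ups_sets Ups_S _ alpha_pos])
      show "finite_measure \<Upsilon>" by unfold_locales
      show "((\<lambda>(x, z). h x z) \<longlongrightarrow> g z) (at_top \<times>\<^sub>F inf (nhds z) (principal ({1..} \<times> ?S)))"
        if "z \<in> {1..} \<times> ?S" for z
        unfolding h_def g_def P_def
        by (rule tendsto_integral_orbit[OF D \<Phi>D \<phi>D lim zero f(1) C that])
    qed (use \<mu>_rect \<nu>_rect h_meas g_meas h_C g_C in auto)

    \<comment> \<open>Only eventual, since \<open>Q x\<close> is a probability measure only when
      \<open>B x\<close> has positive mass. The law of \<open>polar x\<close> is pulled back to that
      of \<open>X0\<close>, and independence under \<open>Q x\<close> turns the iterated integral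
      into one over the joint law.\<close>
    have left: "\<forall>\<^sub>F x in at_top. (\<integral>z. h x z \<partial>\<mu> x) = (\<integral>z. f z \<partial>cond_law M borel
        (\<lambda>\<omega>. (norm (X0 \<omega>) / x, trunc_seq t (\<lambda>j. Xseq Phi X0 eps j \<omega> /\<^sub>R norm (X0 \<omega>)))) (B x))"
      using good
    proof eventually_elim
      case (elim x)
      interpret Q: prob_space "Q x" using elim by (intro Q_prob) simp
      interpret QX: prob_space "distr (Q x) borel X0"
        by (rule Q.prob_space_distr) measurable
      have VMP: "?VM \<in> M \<rightarrow>\<^sub>M P" using VM by (simp add: measurable_cong_sets[OF refl sets_P])
      define k where "k p = f (norm (fst p) / x, trunc_seq t (\<lambda>j. orbit Phi (fst p) (snd p) j /\<^sub>R norm (fst p)))"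
        for p :: "'a \<times> (nat \<Rightarrow> 'e)"
      have k_meas: "k \<in> borel_measurable (borel \<Otimes>\<^sub>M P)"
        unfolding k_def
        by (intro measurable_compose[OF _ f_meas] measurable_Pair measurable_trunc_seq
            borel_measurable_scaleR orbit_meas \<Phi>D) measurable
      have joint: "distr (Q x) (borel \<Otimes>\<^sub>M P) (\<lambda>\<omega>. (X0 \<omega>, ?VM \<omega>)) = distr (Q x) borel X0 \<Otimes>\<^sub>M P"
      proof -
        have "{y::'a. norm y > x} \<in> sets borel" by measurable
        from distr_uniform_indep_var_het[OF M X0_indep this B_vimage] elim
        have "distr (Q x) (borel \<Otimes>\<^sub>M ?PE) (\<lambda>\<omega>. (X0 \<omega>, ?VM \<omega>)) = distr (Q x) borel X0 \<Otimes>\<^sub>M P"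
          unfolding Q_def VM_law by blast
        moreover have "distr (Q x) (borel \<Otimes>\<^sub>M P) (\<lambda>\<omega>. (X0 \<omega>, ?VM \<omega>)) = distr (Q x) (borel \<Otimes>\<^sub>M ?PE) (\<lambda>\<omega>. (X0 \<omega>, ?VM \<omega>))"
          by (rule distr_cong[OF refl sets_pair_measure_cong[OF refl sets_P] refl])
        ultimately show ?thesis by simp
      qed
      \<comment> \<open>At \<open>y = 0\<close> polar coordinates carry no information, but both
        sides start the orbit at 0 and scale by the inverse of 0, so they still agree.\<close>
      have k_h: "(\<integral>v. k (y, v) \<partial>P) = h x (norm y / x, y /\<^sub>R norm y)" for y
        using elim by (cases "y = 0") (simp_all add: h_def k_def)
      have "(\<integral>z. h x z \<partial>\<mu> x) = (\<integral>\<omega>. h x (polar x \<omega>) \<partial>Q x)"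
        unfolding \<mu>_def using h_meas by (intro integral_distr) auto
      also have "\<dots> = (\<integral>\<omega>. (\<integral>v. k (X0 \<omega>, v) \<partial>P) \<partial>Q x)"
        by (simp add: k_h polar_def)
      also have "\<dots> = (\<integral>y. (\<integral>v. k (y, v) \<partial>P) \<partial>distr (Q x) borel X0)"
        by (rule integral_distr[symmetric])
          (use k_meas in \<open>auto intro!: P.borel_measurable_lebesgue_integral\<close>)
      also have "\<dots> = (\<integral>p. k p \<partial>(distr (Q x) borel X0 \<Otimes>\<^sub>M P))"
      proof (rule integral_pair_prob_space[symmetric, OF QX.prob_space_axioms P.prob_space_axioms, where C=C])
        show "k \<in> borel_measurable (distr (Q x) borel X0 \<Otimes>\<^sub>M P)"
          using k_meas by (simp cong: measurable_cong_sets sets_pair_measure_cong)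
      qed (simp add: k_def C)
      also have "\<dots> = (\<integral>\<omega>. k (X0 \<omega>, ?VM \<omega>) \<partial>Q x)"
        unfolding joint[symmetric] using VMP k_meas
        by (intro integral_distr) (auto simp: measurable_cong_sets[OF sets_Q refl])
      also have "\<dots> = (\<integral>\<omega>. f (norm (X0 \<omega>) / x, trunc_seq t (\<lambda>j. Xseq Phi X0 eps j \<omega> /\<^sub>R norm (X0 \<omega>))) \<partial>Q x)"
        unfolding k_def fst_conv snd_conv Xseq_eq_orbit ..
      also have "\<dots> = (\<integral>z. f z \<partial>cond_law M borel
          (\<lambda>\<omega>. (norm (X0 \<omega>) / x, trunc_seq t (\<lambda>j. Xseq Phi X0 eps j \<omega> /\<^sub>R norm (X0 \<omega>)))) (B x))"
        unfolding cond_law_def Q_def[symmetric] Xseq_eq_orbit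
      proof (rule integral_distr[symmetric])
        show "(\<lambda>\<omega>. (norm (X0 \<omega>) / x, trunc_seq t (\<lambda>j. orbit Phi (X0 \<omega>) (?VM \<omega>) j /\<^sub>R norm (X0 \<omega>)))) \<in> borel_measurable (Q x)"
          unfolding borel_prod[symmetric] measurable_cong_sets[OF sets_Q refl]
          by (intro measurable_Pair measurable_trunc_seq borel_measurable_scaleR orbit_meas \<Phi>D VMP) measurable
      qed (rule f_borel)
      finally show ?case .
    qed

    have right: "(\<integral>z. g z \<partial>\<nu>) = (\<integral>z. f z \<partial>distr N borel (\<lambda>\<omega>. (Y \<omega>, trunc_seq t (\<lambda>j. Xseq (phi_ext phi) M0 e j \<omega>))))"
    proof -
      have VNP: "?VN \<in> N \<rightarrow>\<^sub>M P" using VN by (simp add: measurable_cong_sets[OF refl sets_P])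
      define k where "k p = f (fst p, trunc_seq t (\<lambda>j. orbit (phi_ext phi) (fst (snd p)) (snd (snd p)) j))"
        for p :: "real \<times> 'a \<times> (nat \<Rightarrow> 'e)"
      have k_meas: "k \<in> borel_measurable (borel \<Otimes>\<^sub>M (borel \<Otimes>\<^sub>M P))"
        unfolding k_def
        by (intro measurable_compose[OF _ f_meas] measurable_Pair measurable_trunc_seq orbit_meas \<phi>D) measurable
      have k_C: "\<bar>k p\<bar> \<le> C" for p by (simp add: k_def C)
      interpret UP: pair_prob_space \<Upsilon> P ..
      have borel_P: "sets (borel \<Otimes>\<^sub>M P) = sets (borel \<Otimes>\<^sub>M ?PE)" "sets (\<Upsilon> \<Otimes>\<^sub>M P) = sets (borel \<Otimes>\<^sub>M P)"
        by (rule sets_pair_measure_cong[OF refl sets_P], rule sets_pair_measure_cong[OF Ups_sets refl])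
      \<comment> \<open>The two independence assumptions nest: \<open>Y\<close> against the pair of
        \<open>M0\<close> and noise, then \<open>M0\<close> against the noise. Integrating the noise
        out of this triple product leaves \<open>g\<close> against \<open>\<nu>\<close>.\<close>
      have joint: "distr N (borel \<Otimes>\<^sub>M (borel \<Otimes>\<^sub>M P)) (\<lambda>\<omega>. (Y \<omega>, (M0 \<omega>, ?VN \<omega>))) = distr N borel Y \<Otimes>\<^sub>M (\<Upsilon> \<Otimes>\<^sub>M P)"
      proof -
        have "distr N (borel \<Otimes>\<^sub>M (borel \<Otimes>\<^sub>M P)) (\<lambda>\<omega>. (Y \<omega>, (M0 \<omega>, ?VN \<omega>)))
            = distr N (borel \<Otimes>\<^sub>M (borel \<Otimes>\<^sub>M ?PE)) (\<lambda>\<omega>. (Y \<omega>, (M0 \<omega>, ?VN \<omega>)))"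
          by (rule distr_cong[OF refl sets_pair_measure_cong[OF refl borel_P(1)] refl])
        then show ?thesis
          by (simp only: distr_indep_var_het[OF N Y_indep] distr_indep_var_het[OF N M0_indep] M0_law VN_law)
      qed
      have k_u: "(\<lambda>p. k (u, p)) \<in> borel_measurable (\<Upsilon> \<Otimes>\<^sub>M P)" for u
        using measurable_compose[OF measurable_Pair1' k_meas, of u]
        by (simp add: measurable_cong_sets[OF borel_P(2) refl])
      have "(\<integral>z. g z \<partial>\<nu>) = (\<integral>u. (\<integral>s. g (u, s) \<partial>\<Upsilon>) \<partial>distr N borel Y)"
        unfolding \<nu>_def
        by (rule integral_pair_prob_space[OF Y.prob_space_axioms U.prob_space_axioms, where C=C])
          (use g_meas sets_\<nu> g_C in \<open>auto simp: \<nu>_def cong: measurable_cong_sets\<close>)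
      also have "\<dots> = (\<integral>u. (\<integral>s. (\<integral>v. k (u, (s, v)) \<partial>P) \<partial>\<Upsilon>) \<partial>distr N borel Y)"
        by (simp add: g_def k_def)
      also have "\<dots> = (\<integral>u. (\<integral>p. k (u, p) \<partial>(\<Upsilon> \<Otimes>\<^sub>M P)) \<partial>distr N borel Y)"
        by (intro Bochner_Integration.integral_cong refl integral_pair_prob_space[symmetric, where C=C]
            U.prob_space_axioms P.prob_space_axioms k_u k_C)
      also have "\<dots> = (\<integral>p. k p \<partial>(distr N borel Y \<Otimes>\<^sub>M (\<Upsilon> \<Otimes>\<^sub>M P)))"
      proof (rule integral_pair_prob_space[symmetric, where C=C])
        have "sets (distr N borel Y \<Otimes>\<^sub>M (\<Upsilon> \<Otimes>\<^sub>M P)) = sets (borel \<Otimes>\<^sub>M (borel \<Otimes>\<^sub>M P))"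
          by (rule sets_pair_measure_cong) (simp_all add: borel_P)
        with k_meas show "k \<in> borel_measurable (distr N borel Y \<Otimes>\<^sub>M (\<Upsilon> \<Otimes>\<^sub>M P))"
          by (simp cong: measurable_cong_sets)
      qed (rule Y.prob_space_axioms UP.prob_space_axioms k_C)+
      also have "\<dots> = (\<integral>\<omega>. k (Y \<omega>, (M0 \<omega>, ?VN \<omega>)) \<partial>N)"
        unfolding joint[symmetric] using k_meas VNP by (intro integral_distr) auto
      also have "\<dots> = (\<integral>\<omega>. f (Y \<omega>, trunc_seq t (\<lambda>j. Xseq (phi_ext phi) M0 e j \<omega>)) \<partial>N)"
        unfolding k_def fst_conv snd_conv Xseq_eq_orbit ..
      also have "\<dots> = (\<integral>z. f z \<partial>distr N borel (\<lambda>\<omega>. (Y \<omega>, trunc_seq t (\<lambda>j. Xseq (phi_ext phi) M0 e j \<omega>))))"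
        unfolding Xseq_eq_orbit
      proof (rule integral_distr[symmetric])
        show "(\<lambda>\<omega>. (Y \<omega>, trunc_seq t (\<lambda>j. orbit (phi_ext phi) (M0 \<omega>) (?VN \<omega>) j))) \<in> borel_measurable N"
          unfolding borel_prod[symmetric]
          by (intro measurable_Pair measurable_trunc_seq orbit_meas \<phi>D VNP) measurable
      qed (rule f_borel)
      finally show ?thesis .
    qed
    show "((\<lambda>x. \<integral>z. f z \<partial>cond_law M borel
          (\<lambda>\<omega>. (norm (X0 \<omega>) / x, trunc_seq t (\<lambda>j. Xseq Phi X0 eps j \<omega> /\<^sub>R norm (X0 \<omega>))))
          {\<omega> \<in> space M. norm (X0 \<omega>) > x})
        \<longlongrightarrow> (\<integral>z. f z \<partial>distr N borel (\<lambda>\<omega>. (Y \<omega>, trunc_seq t (\<lambda>j. Xseq (phi_ext phi) M0 e j \<omega>))))) at_top"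
      using tendsto_cong[THEN iffD1, OF left hg] by (simp only: right B_def)
  qed
qed

end
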